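(* Let $n$ be a positive integer, let $a$ and $b$ be nonzero constants, and let $f$ be a smooth function of $u$ such that $f_{uu}\neq 0$ (that is, $f_{uu}$ is not identically zero). Consider the partial differential equation $$u_{tx}+(f(u))_{tt}+a\,u_{ttt}+b\,\Delta_y u=0 \qquad (\mathrm{E})$$ for one dependent variable $u$ in the $n+2$ independent variables $x,t,y_1,\dots,y_n$, where $\Delta_y=\sum_{i=1}^n \partial^2/\partial y_i^2$. Then all nontrivial local conservation laws of (E), of all orders, are, modulo the addition of trivial ones, of the following form, written as an identity holding modulo (E) and its differential consequences: $$\bigl((u_x+f'(u)u_t+a u_{tt})\chi-(a u_t+f(u))\chi_t\bigr)_t+(-u\chi_t)_x+\sum_{j=1}^n\bigl(b(u_{y_j}\chi-u\chi_{y_j})\bigr)_{y_j}=0,$$ where $\chi=\varphi_0+t\varphi_1$ and $\varphi_\alpha=\varphi_\alpha(x,y_1,\dots,y_n)$, $\alpha=0,1$, are arbitrary smooth functions of their arguments satisfying the linear system $$\Delta_y\varphi_1=0,\qquad \Delta_y\varphi_0=-(\varphi_1)_x/b .$$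
   Context: Subscripts denote partial derivatives (total derivatives when applied to expressions depending on $u$ and its derivatives), and $f'(u)=f_u=df/du$. A differential function is a smooth function depending on $x,t,y_1,\dots,y_n$, $u$ and finitely many derivatives of $u$. Let $D_t,D_x,D_{y_j}$ denote the total derivatives. A local conservation law of (E) is a tuple $(\rho,\sigma,\zeta_1,\dots,\zeta_n)$ of differential functions such that $D_t\rho+D_x\sigma+\sum_{j=1}^n D_{y_j}\zeta_j=0$ holds modulo (E) and its differential consequences (i.e. on all solutions of (E)). It is written as this divergence identity. A local conservation law is trivial if its tuple is a sum of two tuples of differential functions: one whose components all vanish modulo (E) and its differential consequences, and one whose total divergence $D_t\rho+D_x\sigma+\sum_j D_{y_j}\zeta_j$ vanishes identically (for all functions $u$, without using (E)). It is nontrivial otherwise. Two local conservation laws are equivalent if they differ by a trivial one. *)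

theory Defs
  imports "HOL-Analysis.Analysis" "HOL-Library.Multiset"
begin

datatype 'n ivar = VX | VT | VY 'n

text \<open>
  Coordinates on the infinite jet space of one dependent variable \<open>u\<close>: the independent
  variables, and the derivatives of \<open>u\<close>. A derivative is named by the multiset of variables in
  which \<open>u\<close> is differentiated, so \<open>Der {#VT, VX#}\<close> is $u_{tx}$ and \<open>Der {#}\<close> is \<open>u\<close> itself.
\<close>

datatype 'n coord = Ind "'n ivar" | Der "'n ivar multiset"

type_synonym 'n jet = "'n coord \<Rightarrow> real"

definition partial :: "'c \<Rightarrow> (('c \<Rightarrow> real) \<Rightarrow> real) \<Rightarrow> ('c \<Rightarrow> real) \<Rightarrow> real" where
  "partial c F z = deriv (\<lambda>s. F (z(c := s))) (z c)"

text \<open>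
  All iterated partial derivatives exist and are continuous. Continuity refers to the product
  topology; for a function of finitely many coordinates this is ordinary continuity in these
  coordinates, so such a function is smooth in this sense iff it is $C^\infty$ in the usual one.
\<close>

definition smooth :: "(('c \<Rightarrow> real) \<Rightarrow> real) \<Rightarrow> bool" where
  "smooth F \<longleftrightarrow> (\<forall>cs. continuous_on UNIV (foldr partial cs F) \<and>
     (\<forall>c z. (\<lambda>s. foldr partial cs F (z(c := s))) differentiable at (z c)))"

definition smooth_real :: "(real \<Rightarrow> real) \<Rightarrow> bool" where
  "smooth_real f \<longleftrightarrow> (\<forall>k x. (deriv ^^ k) f differentiable at x)"

definition depends_only :: "'c set \<Rightarrow> (('c \<Rightarrow> real) \<Rightarrow> real) \<Rightarrow> bool" where
  "depends_only S F \<longleftrightarrow> (\<forall>z w. (\<forall>c\<in>S. z c = w c) \<longrightarrow> F z = F w)"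

definition diff_fun :: "('n jet \<Rightarrow> real) \<Rightarrow> bool" where
  "diff_fun F \<longleftrightarrow> smooth F \<and> (\<exists>S. finite S \<and> depends_only S F)"

text \<open>
  The sum ranges over the derivatives on which \<open>F\<close> effectively depends; these are finitely many
  if \<open>F\<close> is a differential function.
\<close>

definition total_deriv :: "'n ivar \<Rightarrow> ('n jet \<Rightarrow> real) \<Rightarrow> 'n jet \<Rightarrow> real" where
  "total_deriv i F z = partial (Ind i) F z +
     (\<Sum>J | partial (Der J) F \<noteq> (\<lambda>_. 0). z (Der (add_mset i J)) * partial (Der J) F z)"

definition u_coord :: "'n jet \<Rightarrow> real" where
  "u_coord z = z (Der {#})"

definition laplace_y :: "('n::finite jet \<Rightarrow> real) \<Rightarrow> 'n jet \<Rightarrow> real" where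
  "laplace_y F z = (\<Sum>j\<in>UNIV. total_deriv (VY j) (total_deriv (VY j) F) z)"

text \<open>The left-hand side of $u_{tx} + (f(u))_{tt} + a u_{ttt} + b \Delta_y u = 0$.\<close>

definition eqn :: "(real \<Rightarrow> real) \<Rightarrow> real \<Rightarrow> real \<Rightarrow> 'n::finite jet \<Rightarrow> real" where
  "eqn f a b z =
     total_deriv VX (total_deriv VT u_coord) z
     + total_deriv VT (total_deriv VT (\<lambda>w. f (u_coord w))) z
     + a * total_deriv VT (total_deriv VT (total_deriv VT u_coord)) z
     + b * laplace_y u_coord z"

text \<open>
  The infinite prolongation of the equation \<open>E = 0\<close>: the jets that satisfy the equation together
  with all its differential consequences. A function of jets vanishes modulo the equation and its
  differential consequences if it vanishes at all these points.
\<close>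

definition prolongation :: "('n jet \<Rightarrow> real) \<Rightarrow> 'n jet set" where
  "prolongation E = {z. \<forall>is. foldr total_deriv is E z = 0}"

definition vanishes_mod :: "('n jet \<Rightarrow> real) \<Rightarrow> ('n jet \<Rightarrow> real) \<Rightarrow> bool" where
  "vanishes_mod E F \<longleftrightarrow> (\<forall>z\<in>prolongation E. F z = 0)"

text \<open>
  A tuple $(\rho,\sigma,\zeta_1,\dots,\zeta_n)$ is indexed by the variables in which its
  components are differentiated: $\rho$ is \<open>P VT\<close>, $\sigma$ is \<open>P VX\<close> and $\zeta_j$ is \<open>P (VY j)\<close>.
\<close>

type_synonym 'n current = "'n ivar \<Rightarrow> 'n jet \<Rightarrow> real"

definition total_div :: "'n::finite current \<Rightarrow> 'n jet \<Rightarrow> real" where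
  "total_div P z = total_deriv VT (P VT) z + total_deriv VX (P VX) z
     + (\<Sum>j\<in>UNIV. total_deriv (VY j) (P (VY j)) z)"

definition conservation_law :: "('n::finite jet \<Rightarrow> real) \<Rightarrow> 'n current \<Rightarrow> bool" where
  "conservation_law E P \<longleftrightarrow> (\<forall>i. diff_fun (P i)) \<and> vanishes_mod E (total_div P)"

definition trivial_law :: "('n::finite jet \<Rightarrow> real) \<Rightarrow> 'n current \<Rightarrow> bool" where
  "trivial_law E P \<longleftrightarrow> conservation_law E P \<and>
     (\<exists>N Q. (\<forall>i. diff_fun (N i) \<and> vanishes_mod E (N i)) \<and>
            (\<forall>i. diff_fun (Q i)) \<and> (\<forall>z. total_div Q z = 0) \<and>
            (\<forall>i z. P i z = N i z + Q i z))"

definition nontrivial_law :: "('n::finite jet \<Rightarrow> real) \<Rightarrow> 'n current \<Rightarrow> bool" where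
  "nontrivial_law E P \<longleftrightarrow> conservation_law E P \<and> \<not> trivial_law E P"

definition equivalent_laws :: "('n::finite jet \<Rightarrow> real) \<Rightarrow> 'n current \<Rightarrow> 'n current \<Rightarrow> bool" where
  "equivalent_laws E P Q \<longleftrightarrow> conservation_law E P \<and> conservation_law E Q \<and>
     trivial_law E (\<lambda>i z. P i z - Q i z)"

text \<open>Smooth functions of $x, y_1, \dots, y_n$, regarded as functions of jets.\<close>

definition xy_fun :: "('n jet \<Rightarrow> real) \<Rightarrow> bool" where
  "xy_fun F \<longleftrightarrow> smooth F \<and> depends_only (insert (Ind VX) (range (\<lambda>j. Ind (VY j)))) F"

definition phi_system ::
    "real \<Rightarrow> ('n::finite jet \<Rightarrow> real) \<Rightarrow> ('n jet \<Rightarrow> real) \<Rightarrow> bool" where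
  "phi_system b \<phi>0 \<phi>1 \<longleftrightarrow>
     (\<forall>z. laplace_y \<phi>1 z = 0) \<and> (\<forall>z. laplace_y \<phi>0 z = - total_deriv VX \<phi>1 z / b)"

definition chi :: "('n jet \<Rightarrow> real) \<Rightarrow> ('n jet \<Rightarrow> real) \<Rightarrow> 'n jet \<Rightarrow> real" where
  "chi \<phi>0 \<phi>1 z = \<phi>0 z + z (Ind VT) * \<phi>1 z"

fun chi_current :: "(real \<Rightarrow> real) \<Rightarrow> real \<Rightarrow> real \<Rightarrow> ('n jet \<Rightarrow> real) \<Rightarrow> 'n current" where
  "chi_current f a b h VT z =
     (total_deriv VX u_coord z + deriv f (u_coord z) * total_deriv VT u_coord z
        + a * total_deriv VT (total_deriv VT u_coord) z) * h z
     - (a * total_deriv VT u_coord z + f (u_coord z)) * total_deriv VT h z"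
| "chi_current f a b h VX z = - u_coord z * total_deriv VT h z"
| "chi_current f a b h (VY j) z =
     b * (total_deriv (VY j) u_coord z * h z - u_coord z * total_deriv (VY j) h z)"

end

theory Submission
  imports Defs
begin

text \<open>
  The equation can be solved for \<open>u\<^bsub>ttt\<^esub>\<close> with a right-hand side that contains at most two
  \<open>t\<close>-derivatives. Hence the jets that satisfy the equation and all its differential consequences
  form a graph over the coordinates with at most two \<open>t\<close>-derivatives, and there is a smooth
  retraction of the jet space onto this graph. Composing a conserved current with the retraction
  alters it only by functions that vanish on solutions. The divergence of the new current is, as an
  identity in all jets, a combination of space derivatives of the equation; integration by
  parts turns it into \<open>\<Lambda> E\<close> with a single multiplier \<open>\<Lambda>\<close> that again contains at most two
  \<open>t\<close>-derivatives (\<open>characteristic_form\<close>). A current with divergence identically zero is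
  trivial, so a conservation law is determined by \<open>\<Lambda>\<close> up to equivalence.

  It remains to find all \<open>\<Lambda>\<close>. Since \<open>\<Lambda> E\<close> is a divergence, the Euler operator annihilates it, and
  on solutions this says that \<open>\<Lambda>\<close> satisfies the adjoint of the linearised equation
  (\<open>multiplier_equation_on_shell\<close>, \<open>euler_pair_eqn\<close>):
  \<open>\<Lambda>\<^bsub>tx\<^esub> + f'(u) \<Lambda>\<^bsub>tt\<^esub> - a \<Lambda>\<^bsub>ttt\<^esub> + b \<Delta>\<Lambda> = 0\<close>. The equation itself has \<open>+ a u\<^bsub>ttt\<^esub>\<close>, and this
  change of sign is decisive. Give \<open>t\<close> weight 2, one of the \<open>y\<^sub>j\<close> weight 3 and the other
  variables weight 0. If \<open>\<Lambda>\<close> depends on derivatives of \<open>u\<close>, let \<open>u\<^sub>J\<close> be one of greatest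
  weight among them. In the highest weight, the terms with \<open>a\<close> and \<open>b\<close> in the adjoint equation
  would cancel on solutions if their signs were those of the equation. As the signs differ, they
  add up to \<open>2 b\<close> times the derivative of \<open>\<Lambda>\<close> by \<open>u\<^sub>J\<close> in front of a coordinate that is free on
  solutions; so this derivative is zero (\<open>leading_coefficient_zero\<close>).

  Therefore \<open>\<Lambda>\<close> depends on the independent variables only. Then \<open>u\<close> enters the adjoint equation
  only through \<open>f'(u)\<close>, which is not constant, so \<open>\<Lambda>\<^bsub>tt\<^esub> = 0\<close> and \<open>\<Lambda> = \<phi>\<^sub>0 + t \<phi>\<^sub>1\<close>; the rest of
  the adjoint equation is the system for \<open>\<phi>\<^sub>0\<close> and \<open>\<phi>\<^sub>1\<close>. The current displayed in the theorem has
  divergence \<open>\<chi> E\<close> identically (\<open>total_div_chi_current\<close>), which gives both its conservation and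
  the equivalence.

  The calculus of differential functions, in particular chain rule and symmetry of mixed
  derivatives for functions on the infinite jet space, is developed from the definition of
  smoothness by iterated partial derivatives.
\<close>

section \<open>Smooth functions of infinitely many coordinates\<close>

lemma depends_onlyD: "depends_only S F \<Longrightarrow> (\<And>c. c \<in> S \<Longrightarrow> z c = w c) \<Longrightarrow> F z = F w"
  unfolding depends_only_def by blast

lemma depends_only_mono: "depends_only S F \<Longrightarrow> S \<subseteq> T \<Longrightarrow> depends_only T F"
  unfolding depends_only_def by blast

text \<open>
  Function spaces carry the product topology, so limits of points are limits of coordinates. This
  is what turns the continuity of partial derivatives into usable limits below.
\<close>

lemma tendsto_coordinatewise:
  fixes h :: "'a \<Rightarrow> 'c \<Rightarrow> real"
  assumes "\<And>c. ((\<lambda>s. h s c) \<longlongrightarrow> p c) G"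
  shows "(h \<longlongrightarrow> p) G"
proof -
  have "limitin (product_topology (\<lambda>_. euclidean) UNIV) h p G"
    unfolding limitin_componentwise using assms by (simp add: limitin_canonical_iff)
  then show ?thesis
    by (simp add: euclidean_product_topology limitin_canonical_iff)
qed

lemma tendsto_coordinate:
  fixes h :: "'a \<Rightarrow> 'c \<Rightarrow> real"
  assumes "(h \<longlongrightarrow> p) G"
  shows "((\<lambda>s. h s c) \<longlongrightarrow> p c) G"
  by (rule continuous_on_tendsto_compose[OF continuous_on_product_coordinates assms]) auto

lemma tendsto_fun_upd:
  fixes h :: "'a \<Rightarrow> 'c \<Rightarrow> real"
  assumes "\<And>d. ((\<lambda>s. h s d) \<longlongrightarrow> p d) G" "(\<theta> \<longlongrightarrow> x) G"
  shows "((\<lambda>s. (h s)(c := \<theta> s)) \<longlongrightarrow> p(c := x)) G"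
proof (rule tendsto_coordinatewise)
  fix d show "((\<lambda>s. ((h s)(c := \<theta> s)) d) \<longlongrightarrow> (p(c := x)) d) G"
    by (cases "d = c") (simp_all add: assms)
qed

lemma smooth_coinduct:
  assumes "F \<in> X"
    and cont: "\<And>F. F \<in> X \<Longrightarrow> continuous_on UNIV F"
    and diff: "\<And>F c z. F \<in> X \<Longrightarrow> (\<lambda>s. F (z(c := s))) differentiable at (z c)"
    and part: "\<And>F c. F \<in> X \<Longrightarrow> partial c F \<in> X"
  shows "smooth F"
proof -
  have "foldr partial cs F \<in> X" for cs
    by (induction cs) (auto simp: assms(1) part)
  then show ?thesis unfolding smooth_def using cont diff by blast
qed

lemma smooth_continuous: "smooth F \<Longrightarrow> continuous_on UNIV F"
  unfolding smooth_def by (metis foldr_Nil id_apply)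

lemma smooth_partial: assumes "smooth F" shows "smooth (partial c F)"
  unfolding smooth_def
proof
  fix cs
  have "foldr partial cs (partial c F) = foldr partial (cs @ [c]) F" by simp
  then show "continuous_on UNIV (foldr partial cs (partial c F)) \<and>
     (\<forall>d z. (\<lambda>s. foldr partial cs (partial c F) (z(d := s))) differentiable at (z d))"
    using assms unfolding smooth_def by metis
qed

lemma smooth_differentiable: "smooth F \<Longrightarrow> (\<lambda>s. F (z(c := s))) differentiable at (z c)"
  unfolding smooth_def by (metis foldr_Nil id_apply)

lemma partial_eqI:
  "((\<lambda>s. F (z(c := s))) has_real_derivative D) (at (z c)) \<Longrightarrow> partial c F z = D"
  unfolding partial_def by (rule DERIV_imp_deriv)

lemma smooth_has_partial:
  assumes "smooth F"
  shows "((\<lambda>s. F (z(c := s))) has_real_derivative partial c F (z(c := x))) (at x)"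
proof -
  have "(\<lambda>s. F ((z(c := x))(c := s))) differentiable at ((z(c := x)) c)"
    by (rule smooth_differentiable[OF assms])
  then obtain D where D: "((\<lambda>s. F ((z(c := x))(c := s))) has_real_derivative D) (at ((z(c := x)) c))"
    by (auto simp: real_differentiable_def)
  have "partial c F (z(c := x)) = D" using D by (rule partial_eqI)
  then show ?thesis using D by (simp add: fun_upd_def cong: if_cong)
qed

lemma smooth_has_partial':
  assumes "smooth F"
  shows "((\<lambda>s. F (z(c := s))) has_real_derivative partial c F z) (at (z c))"
  using smooth_has_partial[OF assms, of z c "z c"] by simp

text \<open>
  Smoothness is proved by coinduction: it suffices to exhibit a set of continuous functions that
  contains \<open>F\<close> and, with each member, a partial derivative in every direction.
\<close>

lemma smoothI:
  assumes "F \<in> X"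
    and cont: "\<And>F. F \<in> X \<Longrightarrow> continuous_on UNIV F"
    and part: "\<And>F c. F \<in> X \<Longrightarrow>
      \<exists>D\<in>X. \<forall>z. ((\<lambda>s. F (z(c := s))) has_real_derivative D z) (at (z c))"
  shows "smooth F"
proof (rule smooth_coinduct[OF assms(1) cont])
  fix F c z assume F: "F \<in> X"
  then show "(\<lambda>s. F (z(c := s))) differentiable at (z c)"
    using part[of F c] by (auto simp: real_differentiable_def)
  obtain D where D: "D \<in> X" "\<And>z. ((\<lambda>s. F (z(c := s))) has_real_derivative D z) (at (z c))"
    using part[OF F] by blast
  have "partial c F z = D z" for z using D(2)[of z] by (rule partial_eqI)
  then have "partial c F = D" by blast
  then show "partial c F \<in> X" using D by simp
qed

lemma partial_mean_value:
  assumes "smooth F"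
  shows "\<exists>\<theta>. \<bar>\<theta> - x\<bar> \<le> \<bar>y - x\<bar> \<and> F (z(c := y)) - F (z(c := x)) = partial c F (z(c := \<theta>)) * (y - x)"
proof -
  have *: "\<exists>\<theta>. a < \<theta> \<and> \<theta> < b \<and> F (z(c := b)) - F (z(c := a)) = (b - a) * partial c F (z(c := \<theta>))"
    if "a < b" for a b
    by (rule MVT2[OF that]) (rule smooth_has_partial[OF assms])
  consider "x < y" | "x = y" | "y < x" by linarith
  then show ?thesis
  proof cases
    case 1
    then obtain \<theta> where "x < \<theta>" "\<theta> < y"
      "F (z(c := y)) - F (z(c := x)) = (y - x) * partial c F (z(c := \<theta>))" using * by blast
    then show ?thesis by (intro exI[of _ \<theta>]) (simp add: mult.commute)
  next
    case 2 then show ?thesis by (intro exI[of _ x]) simp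
  next
    case 3
    then obtain \<theta> where "y < \<theta>" "\<theta> < x"
      "F (z(c := x)) - F (z(c := y)) = (x - y) * partial c F (z(c := \<theta>))" using * by blast
    then show ?thesis by (intro exI[of _ \<theta>]) (simp add: algebra_simps)
  qed
qed

lemma smooth_isCont: "smooth F \<Longrightarrow> (h \<longlongrightarrow> p) G \<Longrightarrow> ((\<lambda>s. F (h s)) \<longlongrightarrow> F p) G"
  using smooth_continuous[of F] continuous_on_tendsto_compose[of UNIV F h p G] by simp

text \<open>
  The partial derivatives exist and are continuous, which forces differentiability along curves:
  the coordinates in \<open>S\<close> are moved one at a time, and each move is controlled by the mean
  value theorem. Only finitely many coordinates matter, so \<open>\<gamma>\<close> may be arbitrary outside
  \<open>S\<close>.
\<close>

lemma smooth_chain_rule: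
  assumes F: "smooth F" and S: "finite S" "depends_only S F"
    and \<gamma>: "\<And>c. c \<in> S \<Longrightarrow> (\<gamma> c has_real_derivative \<gamma>' c) (at s0)"
  shows "((\<lambda>s. F (\<lambda>c. \<gamma> c s)) has_real_derivative
    (\<Sum>c\<in>S. partial c F (\<lambda>c. \<gamma> c s0) * \<gamma>' c)) (at s0)"
proof -
  define p where "p = (\<lambda>c. \<gamma> c s0)"
  define q where "q = (\<lambda>T s c. if c \<in> T then \<gamma> c s else p c)"
  have q_lim: "((\<lambda>s. q T s c) \<longlongrightarrow> p c) (at s0)" if "T \<subseteq> S" for T c
    using that DERIV_isCont[OF \<gamma>, of c] unfolding q_def p_def
    by (cases "c \<in> T") (auto simp: isCont_def)
  have "((\<lambda>s. F (q T s)) has_real_derivative (\<Sum>c\<in>T. partial c F p * \<gamma>' c)) (at s0)"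
    if "finite T" "T \<subseteq> S" for T
    using that
  proof (induction T rule: finite_induct)
    case empty
    then show ?case by (simp add: q_def)
  next
    case (insert c T)
    \<comment> \<open>the increment caused by moving coordinate \<open>c\<close> after those in \<open>T\<close>\<close>
    define \<psi> where "\<psi> = (\<lambda>s. F ((q T s)(c := \<gamma> c s)) - F ((q T s)(c := p c)))"
    have "\<exists>\<theta>. \<bar>\<theta> - p c\<bar> \<le> \<bar>\<gamma> c s - p c\<bar> \<and>
        \<psi> s = partial c F ((q T s)(c := \<theta>)) * (\<gamma> c s - p c)" for s
      unfolding \<psi>_def by (rule partial_mean_value[OF F])
    then obtain \<theta> where \<theta>: "\<And>s. \<bar>\<theta> s - p c\<bar> \<le> \<bar>\<gamma> c s - p c\<bar>"
        "\<And>s. \<psi> s = partial c F ((q T s)(c := \<theta> s)) * (\<gamma> c s - p c)" by metis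
    have g: "(\<gamma> c has_real_derivative \<gamma>' c) (at s0)" using \<gamma> insert by auto
    have "(\<gamma> c \<longlongrightarrow> p c) (at s0)" using DERIV_isCont[OF g] by (simp add: isCont_def p_def)
    then have "((\<lambda>s. \<gamma> c s - p c) \<longlongrightarrow> 0) (at s0)" by (simp add: LIM_zero)
    then have "((\<lambda>s. \<theta> s - p c) \<longlongrightarrow> 0) (at s0)"
      by (rule Lim_null_comparison[rotated, OF tendsto_rabs_zero]) (simp add: \<theta>)
    then have "(\<theta> \<longlongrightarrow> p c) (at s0)" by (simp add: LIM_zero_iff)
    then have "((\<lambda>s. (q T s)(c := \<theta> s)) \<longlongrightarrow> p(c := p c)) (at s0)"
      using insert.prems by (intro tendsto_fun_upd q_lim) auto
    then have "((\<lambda>s. (q T s)(c := \<theta> s)) \<longlongrightarrow> p) (at s0)" by simp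
    then have "((\<lambda>s. partial c F ((q T s)(c := \<theta> s))) \<longlongrightarrow> partial c F p) (at s0)"
      by (rule smooth_isCont[OF smooth_partial[OF F]])
    moreover have "((\<lambda>s. (\<gamma> c s - p c) / (s - s0)) \<longlongrightarrow> \<gamma>' c) (at s0)"
      using g unfolding has_field_derivative_iff p_def .
    ultimately have "((\<lambda>s. partial c F ((q T s)(c := \<theta> s)) * ((\<gamma> c s - p c) / (s - s0)))
        \<longlongrightarrow> partial c F p * \<gamma>' c) (at s0)" by (rule tendsto_mult)
    moreover have "\<psi> s0 = 0" by (simp add: \<psi>_def p_def)
    ultimately have "(\<psi> has_real_derivative partial c F p * \<gamma>' c) (at s0)"
      unfolding has_field_derivative_iff \<open>\<psi> s0 = 0\<close> by (simp add: \<theta>(2))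
    moreover have "((\<lambda>s. F (q T s)) has_real_derivative (\<Sum>c\<in>T. partial c F p * \<gamma>' c)) (at s0)"
      using insert by simp
    ultimately have "((\<lambda>s. \<psi> s + F (q T s)) has_real_derivative
        partial c F p * \<gamma>' c + (\<Sum>c\<in>T. partial c F p * \<gamma>' c)) (at s0)" by (rule DERIV_add)
    moreover have "\<psi> s + F (q T s) = F (q (insert c T) s)" for s
    proof -
      have "(q T s)(c := p c) = q T s" using insert by (auto simp: q_def)
      moreover have "(q T s)(c := \<gamma> c s) = q (insert c T) s" by (auto simp: q_def)
      ultimately show ?thesis by (simp add: \<psi>_def)
    qed
    ultimately show ?case using insert by simp
  qed
  from this[OF S(1) order_refl] have
    "((\<lambda>s. F (q S s)) has_real_derivative (\<Sum>c\<in>S. partial c F p * \<gamma>' c)) (at s0)" .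
  moreover have "F (q S s) = F (\<lambda>c. \<gamma> c s)" for s
    by (rule depends_onlyD[OF S(2)]) (simp add: q_def)
  ultimately show ?thesis by (simp add: p_def)
qed

text \<open>
  Schwarz: the second difference over a square of side \<open>h\<close> is \<open>h\<^sup>2\<close> times either mixed
  derivative, taken at some point of the square; then \<open>h\<close> tends to 0.
\<close>

lemma partial_commute:
  assumes F: "smooth F"
  shows "partial c (partial d F) = partial d (partial c F)"
proof (cases "c = d")
  case False
  show ?thesis
  proof
    fix z
    define \<Delta> where "\<Delta> = (\<lambda>c d h. (F (z(c := z c + h, d := z d + h)) - F (z(c := z c + h)))
      - (F (z(d := z d + h)) - F z))"
    have quotient: "((\<lambda>n. \<Delta> c d (1 / real (Suc n)) / (1 / real (Suc n))\<^sup>2) \<longlonglongrightarrow>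
        partial d (partial c F) z)" if cd: "c \<noteq> d" for c d
    proof -
      have "\<exists>\<xi> \<eta>. \<bar>\<xi>\<bar> \<le> h \<and> \<bar>\<eta>\<bar> \<le> h \<and>
          \<Delta> c d h = h\<^sup>2 * partial d (partial c F) (z(c := z c + \<xi>, d := z d + \<eta>))" if h: "h > 0" for h
      proof -
        define g where "g = (\<lambda>s. F (z(d := z d + h, c := s)) - F (z(c := s)))"
        have "\<exists>\<theta>. z c < \<theta> \<and> \<theta> < z c + h \<and> g (z c + h) - g (z c) =
          (z c + h - z c) * (partial c F (z(d := z d + h, c := \<theta>)) - partial c F (z(c := \<theta>)))"
          using h unfolding g_def
          by (intro MVT2 DERIV_diff smooth_has_partial[OF F]) auto
        then obtain \<theta> where \<theta>: "z c < \<theta>" "\<theta> < z c + h" "g (z c + h) - g (z c) =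
          h * (partial c F (z(d := z d + h, c := \<theta>)) - partial c F (z(c := \<theta>)))" by auto
        from partial_mean_value[OF smooth_partial[OF F], of "z d" "z d + h" c "z(c := \<theta>)" d] h
        obtain \<tau> where \<tau>: "\<bar>\<tau> - z d\<bar> \<le> h"
          "partial c F (z(c := \<theta>, d := z d + h)) - partial c F (z(c := \<theta>, d := z d))
            = partial d (partial c F) (z(c := \<theta>, d := \<tau>)) * h" by auto
        have "z(c := \<theta>, d := z d) = z(c := \<theta>)" using cd by (auto simp: fun_eq_iff)
        moreover have "g (z c + h) - g (z c) = \<Delta> c d h"
          using cd by (simp add: g_def \<Delta>_def fun_upd_twist)
        ultimately have "\<Delta> c d h = h\<^sup>2 * partial d (partial c F) (z(c := \<theta>, d := \<tau>))"
          using \<theta>(3) \<tau>(2) cd by (simp add: fun_upd_twist power2_eq_square mult.commute mult.left_commute)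
        then show ?thesis using \<theta>(1,2) \<tau>(1)
          by (intro exI[of _ "\<theta> - z c"] exI[of _ "\<tau> - z d"]) auto
      qed
      then have "\<exists>\<xi> \<eta>. \<bar>\<xi>\<bar> \<le> 1 / real (Suc n) \<and> \<bar>\<eta>\<bar> \<le> 1 / real (Suc n) \<and>
          \<Delta> c d (1 / real (Suc n)) = (1 / real (Suc n))\<^sup>2 *
          partial d (partial c F) (z(c := z c + \<xi>, d := z d + \<eta>))" for n by simp
      then obtain \<xi> \<eta> where \<xi>: "\<And>n. \<bar>\<xi> n\<bar> \<le> 1 / real (Suc n)" and \<eta>: "\<And>n. \<bar>\<eta> n\<bar> \<le> 1 / real (Suc n)"
        and eq: "\<And>n. \<Delta> c d (1 / real (Suc n)) = (1 / real (Suc n))\<^sup>2 *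
          partial d (partial c F) (z(c := z c + \<xi> n, d := z d + \<eta> n))" by metis
      have null: "(\<lambda>n. 1 / real (Suc n)) \<longlonglongrightarrow> 0"
        using LIMSEQ_inverse_real_of_nat by (simp add: inverse_eq_divide)
      have "\<xi> \<longlonglongrightarrow> 0" "\<eta> \<longlonglongrightarrow> 0"
        by (rule Lim_null_comparison[OF _ null], simp add: \<xi> \<eta> del: of_nat_Suc)+
      then have "(\<lambda>n. z c + \<xi> n) \<longlonglongrightarrow> z c" "(\<lambda>n. z d + \<eta> n) \<longlonglongrightarrow> z d"
        using tendsto_add[OF tendsto_const] by fastforce+
      then have "(\<lambda>n. z(c := z c + \<xi> n, d := z d + \<eta> n)) \<longlonglongrightarrow> z(c := z c, d := z d)"
        by (intro tendsto_fun_upd[OF tendsto_coordinate] tendsto_fun_upd tendsto_const)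
      then have "(\<lambda>n. z(c := z c + \<xi> n, d := z d + \<eta> n)) \<longlonglongrightarrow> z" by simp
      from smooth_isCont[OF smooth_partial[OF smooth_partial[OF F]] this]
      show ?thesis by (simp add: eq del: of_nat_Suc)
    qed
    have "\<Delta> c d h = \<Delta> d c h" for h using False by (simp add: \<Delta>_def fun_upd_twist)
    then have "(\<lambda>n. \<Delta> d c (1 / real (Suc n)) / (1 / real (Suc n))\<^sup>2) \<longlonglongrightarrow> partial d (partial c F) z"
      using quotient[OF False] by simp
    then show "partial c (partial d F) z = partial d (partial c F) z"
      using quotient[of d c] False LIMSEQ_unique by blast
  qed
qed simp

lemma smooth_const: "smooth (\<lambda>_. k)"
  by (rule smoothI[of _ "range (\<lambda>k _. k)"]) (auto intro!: exI[of _ 0])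

lemma coordinate_line_derivative:
  "((\<lambda>s. (z(c := s)) d) has_real_derivative (if d = c then 1 else 0)) (at x)"
  by (cases "d = c") auto

lemma smooth_coord: "smooth (\<lambda>z. z c)"
proof (rule smoothI[of _ "insert (\<lambda>z. z c) (range (\<lambda>k _. k))"])
  fix F :: "('a \<Rightarrow> real) \<Rightarrow> real" and d
  assume "F \<in> insert (\<lambda>z. z c) (range (\<lambda>k _. k))"
  then consider "F = (\<lambda>z. z c)" | k where "F = (\<lambda>_. k)" by auto
  then show "\<exists>D\<in>insert (\<lambda>z. z c) (range (\<lambda>k _. k)).
      \<forall>z. ((\<lambda>s. F (z(d := s))) has_real_derivative D z) (at (z d))"
  proof cases
    case 1
    show ?thesis unfolding 1
      by (rule bexI[of _ "\<lambda>_. if c = d then 1 else 0"])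
        (use coordinate_line_derivative in \<open>auto\<close>)
  qed (auto intro!: disjI2 exI[of _ 0])
qed auto

lemma smooth_add: 
  assumes "smooth F" "smooth G"
  shows "smooth (\<lambda>z. F z + G z)"
proof (rule smoothI[of _ "{\<lambda>z. F z + G z |F G. smooth F \<and> smooth G}"])
  fix H :: "('a \<Rightarrow> real) \<Rightarrow> real" and c
  assume "H \<in> {\<lambda>z. F z + G z |F G. smooth F \<and> smooth G}"
  then obtain F G where H: "H = (\<lambda>z. F z + G z)" "smooth F" "smooth G" by auto
  show "continuous_on UNIV H" unfolding H using H by (intro continuous_on_add smooth_continuous)
  show "\<exists>D\<in>{\<lambda>z. F z + G z |F G. smooth F \<and> smooth G}.
      \<forall>z. ((\<lambda>s. H (z(c := s))) has_real_derivative D z) (at (z c))"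
    unfolding H using H
    by (intro bexI[of _ "\<lambda>z. partial c F z + partial c G z"] allI DERIV_add smooth_has_partial')
      (auto intro: smooth_partial)
qed (use assms in auto)

text \<open>
  The linear span of the products of an element of \<open>M\<close> with a smooth function. It serves as the
  coinductive set for products (\<open>M\<close> the smooth functions) and for compositions (\<open>M\<close> the
  functions \<open>F \<circ> g\<close> with fixed inner part): by the Leibniz and chain rules it is closed under
  partial derivatives.
\<close>

inductive_set mult_span :: "(('c \<Rightarrow> real) \<Rightarrow> real) set \<Rightarrow> (('c \<Rightarrow> real) \<Rightarrow> real) set" for M where
  prod: "F \<in> M \<Longrightarrow> smooth G \<Longrightarrow> (\<lambda>z. F z * G z) \<in> mult_span M"
| sum: "A \<in> mult_span M \<Longrightarrow> B \<in> mult_span M \<Longrightarrow> (\<lambda>z. A z + B z) \<in> mult_span M"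
| zero: "(\<lambda>_. 0) \<in> mult_span M"

lemma mult_span_sum:
  "finite S \<Longrightarrow> (\<And>c. c \<in> S \<Longrightarrow> A c \<in> mult_span M) \<Longrightarrow> (\<lambda>z. \<Sum>c\<in>S. A c z) \<in> mult_span M"
  by (induction S rule: finite_induct) (auto intro: mult_span.intros)

lemma smooth_mult_span:
  assumes cont: "\<And>F. F \<in> M \<Longrightarrow> continuous_on UNIV F"
    and part: "\<And>F c. F \<in> M \<Longrightarrow>
      \<exists>D. (\<forall>z. ((\<lambda>s. F (z(c := s))) has_real_derivative D z) (at (z c))) \<and>
        (\<forall>G. smooth G \<longrightarrow> (\<lambda>z. D z * G z) \<in> mult_span M)"
    and "F \<in> mult_span M"
  shows "smooth F"
proof (rule smoothI[OF assms(3)])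
  fix F assume "F \<in> mult_span M"
  then show "continuous_on UNIV F"
    by induction (simp_all add: continuous_on_mult continuous_on_add cont smooth_continuous)
next
  fix F c assume "F \<in> mult_span M"
  then show "\<exists>D\<in>mult_span M. \<forall>z. ((\<lambda>s. F (z(c := s))) has_real_derivative D z) (at (z c))"
  proof induction
    case (prod F G)
    obtain D where D: "\<And>z. ((\<lambda>s. F (z(c := s))) has_real_derivative D z) (at (z c))"
      "\<And>G. smooth G \<Longrightarrow> (\<lambda>z. D z * G z) \<in> mult_span M" using part[OF prod(1)] by blast
    have "((\<lambda>s. F (z(c := s)) * G (z(c := s))) has_real_derivative D z * G z + F z * partial c G z) (at (z c))" for z
      using DERIV_mult'[OF D(1)[of z] smooth_has_partial'[OF prod(2), of z c]] by (simp add: add.commute)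
    moreover have "(\<lambda>z. D z * G z + F z * partial c G z) \<in> mult_span M"
      by (intro mult_span.sum D(2) mult_span.prod smooth_partial prod)
    ultimately show ?case by (intro bexI[of _ "\<lambda>z. D z * G z + F z * partial c G z"]) blast+
  next
    case (sum A B)
    then obtain D E where "D \<in> mult_span M" "\<And>z. ((\<lambda>s. A (z(c := s))) has_real_derivative D z) (at (z c))"
      "E \<in> mult_span M" "\<And>z. ((\<lambda>s. B (z(c := s))) has_real_derivative E z) (at (z c))" by blast
    then show ?case
      by (intro bexI[of _ "\<lambda>z. D z + E z"] allI DERIV_add mult_span.sum) blast+
  next
    case zero
    then show ?case by (intro bexI[of _ "\<lambda>_. 0"]) (auto intro: mult_span.intros)
  qed
qed

lemma smooth_mult:
  assumes "smooth F" "smooth G"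
  shows "smooth (\<lambda>z. F z * G z)"
proof (rule smooth_mult_span[where M = "Collect smooth"])
  fix F :: "('a \<Rightarrow> real) \<Rightarrow> real" and c
  assume F: "F \<in> Collect smooth"
  show "\<exists>D. (\<forall>z. ((\<lambda>s. F (z(c := s))) has_real_derivative D z) (at (z c))) \<and>
        (\<forall>G. smooth G \<longrightarrow> (\<lambda>z. D z * G z) \<in> mult_span (Collect smooth))"
    using F by (intro exI[of _ "partial c F"]) (auto intro: mult_span.prod smooth_partial smooth_has_partial')
qed (use assms in \<open>auto intro: mult_span.prod smooth_continuous\<close>)

lemma partial_compose:
  assumes "smooth F" "finite S" "depends_only S F" "\<And>c. smooth (g c)"
  shows "((\<lambda>s. F (\<lambda>c. g c (z(d := s)))) has_real_derivative
    (\<Sum>c\<in>S. partial c F (\<lambda>c. g c z) * partial d (g c) z)) (at (z d))"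
  using smooth_chain_rule[OF assms(1-3), of "\<lambda>c s. g c (z(d := s))", OF smooth_has_partial'[OF assms(4)]]
  by simp

lemma depends_only_partial:
  assumes "depends_only S F"
  shows "depends_only S (partial c F)"
proof (cases "c \<in> S")
  case True
  have "partial c F z = partial c F w" if "\<forall>d\<in>S. z d = w d" for z w
  proof -
    have "F (z(c := s)) = F (w(c := s))" for s
      by (rule depends_onlyD[OF assms]) (use that in auto)
    then show ?thesis using True that by (simp add: partial_def)
  qed
  then show ?thesis unfolding depends_only_def by blast
next
  case False
  have "F (z(c := s)) = F z" for z s
    by (rule depends_onlyD[OF assms]) (use False in auto)
  then have "partial c F z = 0" for z by (simp add: partial_def)
  then show ?thesis by (simp add: depends_only_def)
qed

lemma partial_outside:
  assumes "depends_only S F" "c \<notin> S"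
  shows "partial c F = (\<lambda>_. 0)"
proof
  fix z
  have "F (z(c := s)) = F z" for s
    by (rule depends_onlyD[OF assms(1)]) (use assms(2) in auto)
  then show "partial c F z = 0" by (simp add: partial_def)
qed

lemma smooth_compose:
  assumes F: "smooth F" "finite S" "depends_only S F" and g: "\<And>c. smooth (g c)"
  shows "smooth (\<lambda>z. F (\<lambda>c. g c z))"
proof -
  define M where "M = {\<lambda>z. F (\<lambda>c. g c z) |F. smooth F \<and> depends_only S F}"
  have "smooth H" if "H \<in> mult_span M" for H
  proof (rule smooth_mult_span[OF _ _ that])
    fix H assume "H \<in> M"
    then obtain F where H: "H = (\<lambda>z. F (\<lambda>c. g c z))" "smooth F" "depends_only S F"
      by (auto simp: M_def)
    have "continuous_on UNIV (\<lambda>z c. g c z)"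
      by (intro continuous_on_coordinatewise_then_product smooth_continuous g)
    then show "continuous_on UNIV H" unfolding H(1)
      by (rule continuous_on_compose2[OF smooth_continuous[OF H(2)]]) auto
    fix d
    have "(\<lambda>z. (\<Sum>c\<in>S. partial c F (\<lambda>c. g c z) * partial d (g c) z) * G z) \<in> mult_span M"
      if "smooth G" for G
    proof -
      have "(\<lambda>z. \<Sum>c\<in>S. partial c F (\<lambda>c. g c z) * (partial d (g c) z * G z)) \<in> mult_span M"
      proof (rule mult_span_sum[OF \<open>finite S\<close>])
        fix c
        have "(\<lambda>z. partial c F (\<lambda>c. g c z)) \<in> M"
          unfolding M_def using smooth_partial[OF H(2)] depends_only_partial[OF H(3)]
          by (intro CollectI exI[of _ "partial c F"]) simp
        then show "(\<lambda>z. partial c F (\<lambda>c. g c z) * (partial d (g c) z * G z)) \<in> mult_span M"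
          by (rule mult_span.prod) (intro smooth_mult smooth_partial g that)
      qed
      then show ?thesis by (simp add: sum_distrib_right mult.assoc)
    qed
    then show "\<exists>D. (\<forall>z. ((\<lambda>s. H (z(d := s))) has_real_derivative D z) (at (z d))) \<and>
        (\<forall>G. smooth G \<longrightarrow> (\<lambda>z. D z * G z) \<in> mult_span M)"
      unfolding H(1)
      by (intro exI[of _ "\<lambda>z. \<Sum>c\<in>S. partial c F (\<lambda>c. g c z) * partial d (g c) z"] conjI allI impI
          partial_compose[OF H(2) F(2) H(3) g])
  qed
  moreover have "(\<lambda>z. F (\<lambda>c. g c z) * 1) \<in> mult_span M"
    by (rule mult_span.prod) (use F in \<open>auto simp: M_def smooth_const\<close>)
  ultimately show ?thesis by simp
qed

lemma smooth_real_coord: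
  assumes "smooth_real h"
  shows "smooth (\<lambda>z. h (z c))"
proof (rule smoothI[of _ "insert (\<lambda>_. 0) (range (\<lambda>k z. (deriv ^^ k) h (z c)))"])
  have d: "((deriv ^^ k) h has_real_derivative (deriv ^^ Suc k) h x) (at x)" for k x
    using assms by (simp add: smooth_real_def DERIV_deriv_iff_real_differentiable)
  show "(\<lambda>z. h (z c)) \<in> insert (\<lambda>_. 0) (range (\<lambda>k z. (deriv ^^ k) h (z c)))"
    by (intro insertI2 range_eqI[of _ _ 0]) simp
  fix F :: "('a \<Rightarrow> real) \<Rightarrow> real" and e
  assume "F \<in> insert (\<lambda>_. 0) (range (\<lambda>k z. (deriv ^^ k) h (z c)))"
  then consider "F = (\<lambda>_. 0)" | k where "F = (\<lambda>z. (deriv ^^ k) h (z c))" by auto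
  note cas = this
  show "continuous_on UNIV F" using cas
  proof cases
    case (2 k)
    have "continuous_on UNIV ((deriv ^^ k) h)"
      using d DERIV_isCont continuous_at_imp_continuous_on by blast
    then show ?thesis unfolding 2
      by (rule continuous_on_compose2[OF _ continuous_on_product_coordinates]) auto
  qed simp
  show "\<exists>D\<in>insert (\<lambda>_. 0) (range (\<lambda>k z. (deriv ^^ k) h (z c))).
      \<forall>z. ((\<lambda>s. F (z(e := s))) has_real_derivative D z) (at (z e))"
    using cas
  proof cases
    case (2 k)
    show ?thesis
    proof (cases "e = c")
      case True
      then show ?thesis unfolding 2
        by (intro bexI[of _ "\<lambda>z. (deriv ^^ Suc k) h (z c)"] insertI2 range_eqI[of _ _ "Suc k"])
          (use d[of k] in auto)
    next
      case False
      then show ?thesis unfolding 2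
        by (intro bexI[of _ "\<lambda>z. 0"]) auto
    qed
  qed auto
qed

text \<open>
  If \<open>z\<close> and \<open>w\<close> agree on the intersection, the point that equals \<open>z\<close> on \<open>S\<close> and \<open>w\<close>
  elsewhere agrees with the first on \<open>S\<close> and with the second on \<open>T\<close>.
\<close>

lemma depends_only_Int:
  fixes F :: "('a \<Rightarrow> real) \<Rightarrow> real"
  assumes "depends_only S F" "depends_only T F"
  shows "depends_only (S \<inter> T) F"
  unfolding depends_only_def
proof (intro allI impI)
  fix z w :: "'a \<Rightarrow> real" assume eq: "\<forall>c\<in>S \<inter> T. z c = w c"
  define m where "m = (\<lambda>c. if c \<in> S then z c else w c)"
  have "F z = F m" by (rule depends_onlyD[OF assms(1)]) (simp add: m_def)
  also have "F m = F w" by (rule depends_onlyD[OF assms(2)]) (use eq in \<open>auto simp: m_def\<close>)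
  finally show "F z = F w" .
qed

section \<open>Differential functions\<close>

lemma diff_funE:
  assumes "diff_fun F"
  obtains S where "smooth F" "finite S" "depends_only S F"
  using assms unfolding diff_fun_def by blast

lemma diff_funE':
  assumes "diff_fun F" "depends_only T F"
  obtains S where "smooth F" "finite S" "S \<subseteq> T" "depends_only S F"
  using assms depends_only_Int[of T F] unfolding diff_fun_def by (metis finite_Int inf_le1)

lemma diff_funI: "smooth F \<Longrightarrow> finite S \<Longrightarrow> depends_only S F \<Longrightarrow> diff_fun F"
  unfolding diff_fun_def by blast

text \<open>
  A function of finitely many coordinates is constant along every coordinate with vanishing partial
  derivative; these coordinates are removed one by one.
\<close>

lemma depends_only_if_partials_zero:
  fixes F :: "'a jet \<Rightarrow> real"
  assumes "diff_fun F" "\<And>c. c \<notin> T \<Longrightarrow> partial c F = (\<lambda>_. 0)"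
  shows "depends_only T F"
proof -
  obtain S where S: "smooth F" "finite S" "depends_only S F" using assms(1) by (rule diff_funE)
  have "depends_only (S - R) F" if "finite R" "R \<inter> T = {}" for R
    using that
  proof (induction R rule: finite_induct)
    case empty then show ?case using S by simp
  next
    case (insert c R)
    have const: "F (z(c := x)) = F (z(c := y))" for z x y
      by (rule DERIV_isconst_all[of "\<lambda>s. F (z(c := s))"])
        (use smooth_has_partial[OF S(1), of z c] assms(2)[of c] insert.prems in auto)
    have dep: "depends_only (S - R) F" using insert by auto
    show ?case unfolding depends_only_def
    proof (intro allI impI)
      fix z w :: "'a jet" assume eq: "\<forall>d\<in>S - insert c R. z d = w d"
      have "F z = F (z(c := w c))" using const[of z "z c" "w c"] by simp
      also have "\<dots> = F w" by (rule depends_onlyD[OF dep]) (use eq in auto)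
      finally show "F z = F w" .
    qed
  qed
  from this[of "S - T"] S have "depends_only (S - (S - T)) F" by auto
  then show ?thesis by (rule depends_only_mono) auto
qed

lemma diff_fun_const: "diff_fun (\<lambda>_. k)"
  by (rule diff_funI[OF smooth_const, of "{}"]) (auto simp: depends_only_def)

lemma diff_fun_coord: "diff_fun (\<lambda>z. z c)"
  by (rule diff_funI[OF smooth_coord, of "{c}"]) (auto simp: depends_only_def)

lemma diff_fun_add: assumes "diff_fun F" "diff_fun G" shows "diff_fun (\<lambda>z. F z + G z)"
proof -
  obtain S where S: "smooth F" "finite S" "depends_only S F" using assms(1) by (rule diff_funE)
  obtain T where T: "smooth G" "finite T" "depends_only T G" using assms(2) by (rule diff_funE)
  have "depends_only (S \<union> T) F" "depends_only (S \<union> T) G"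
    using depends_only_mono[OF S(3)] depends_only_mono[OF T(3)] by auto
  then have "depends_only (S \<union> T) (\<lambda>z. F z + G z)" unfolding depends_only_def by metis
  then show ?thesis using S T by (intro diff_funI[of _ "S \<union> T"] smooth_add) auto
qed

lemma diff_fun_mult: assumes "diff_fun F" "diff_fun G" shows "diff_fun (\<lambda>z. F z * G z)"
proof -
  obtain S where S: "smooth F" "finite S" "depends_only S F" using assms(1) by (rule diff_funE)
  obtain T where T: "smooth G" "finite T" "depends_only T G" using assms(2) by (rule diff_funE)
  have "depends_only (S \<union> T) F" "depends_only (S \<union> T) G"
    using depends_only_mono[OF S(3)] depends_only_mono[OF T(3)] by auto
  then have "depends_only (S \<union> T) (\<lambda>z. F z * G z)" unfolding depends_only_def by metis
  then show ?thesis using S T by (intro diff_funI[of _ "S \<union> T"] smooth_mult) auto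
qed

lemma diff_fun_uminus: "diff_fun F \<Longrightarrow> diff_fun (\<lambda>z. - F z)"
  using diff_fun_mult[OF diff_fun_const[of "-1"], of F] by simp

lemma diff_fun_diff: "diff_fun F \<Longrightarrow> diff_fun G \<Longrightarrow> diff_fun (\<lambda>z. F z - G z)"
  using diff_fun_add[OF _ diff_fun_uminus, of F G] by simp

lemma diff_fun_sum: "(\<And>i. i \<in> A \<Longrightarrow> diff_fun (F i)) \<Longrightarrow> diff_fun (\<lambda>z. \<Sum>i\<in>A. F i z)"
  by (induction A rule: infinite_finite_induct) (auto intro: diff_fun_const diff_fun_add)

lemma diff_fun_partial: "diff_fun F \<Longrightarrow> diff_fun (partial c F)"
  by (erule diff_funE) (rule diff_funI[OF smooth_partial _ depends_only_partial])

lemma depends_only_compose: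
  fixes g :: "'c \<Rightarrow> ('d \<Rightarrow> real) \<Rightarrow> real"
  assumes "depends_only S F" "\<And>c. c \<in> S \<Longrightarrow> depends_only T (g c)"
  shows "depends_only T (\<lambda>z. F (\<lambda>c. g c z))"
  unfolding depends_only_def
proof (intro allI impI)
  fix z w :: "'d \<Rightarrow> real" assume "\<forall>c\<in>T. z c = w c"
  then show "F (\<lambda>c. g c z) = F (\<lambda>c. g c w)"
    by (intro depends_onlyD[OF assms(1)] depends_onlyD[OF assms(2)]) auto
qed

lemma diff_fun_compose:
  assumes "diff_fun F" "\<And>c. diff_fun (g c)"
  shows "diff_fun (\<lambda>z. F (\<lambda>c. g c z))"
proof -
  obtain S where S: "smooth F" "finite S" "depends_only S F" using assms(1) by (rule diff_funE)
  from assms(2) obtain T where T: "\<And>c. finite (T c)" "\<And>c. depends_only (T c) (g c)"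
    unfolding diff_fun_def by metis
  show ?thesis
  proof (rule diff_funI)
    show "smooth (\<lambda>z. F (\<lambda>c. g c z))"
      using assms(2) by (intro smooth_compose[OF S]) (simp add: diff_fun_def)
    show "depends_only (\<Union>c\<in>S. T c) (\<lambda>z. F (\<lambda>c. g c z))"
      by (rule depends_only_compose[OF S(3)]) (rule depends_only_mono[OF T(2)], auto)
    show "finite (\<Union>c\<in>S. T c)" using S T by auto
  qed
qed

lemma diff_fun_real_coord: "smooth_real h \<Longrightarrow> diff_fun (\<lambda>z. h (z c))"
  by (rule diff_funI[OF smooth_real_coord, of _ "{c}"]) (auto simp: depends_only_def)

lemmas diff_fun_intros = diff_fun_const diff_fun_coord diff_fun_add diff_fun_mult diff_fun_uminus
  diff_fun_diff diff_fun_sum diff_fun_partial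

section \<open>Total derivatives\<close>

text \<open>
  The total derivative in direction \<open>i\<close> is differentiation along a vector field on the jet space;
  this is its component in the direction of the coordinate \<open>c\<close>.
\<close>

fun vfield :: "'n ivar \<Rightarrow> 'n coord \<Rightarrow> 'n jet \<Rightarrow> real" where
  "vfield i (Ind k) z = (if k = i then 1 else 0)"
| "vfield i (Der J) z = z (Der (add_mset i J))"

lemma diff_fun_vfield: "diff_fun (vfield i c)"
proof -
  have "vfield i c = (case c of Ind k \<Rightarrow> (\<lambda>_. if k = i then 1 else 0) | Der J \<Rightarrow> (\<lambda>z. z (Der (add_mset i J))))"
    by (cases c) auto
  then show ?thesis by (auto intro: diff_fun_intros split: coord.split)
qed

lemma total_deriv_eq_sum:
  assumes "finite S" "depends_only S F"
  shows "total_deriv i F z = (\<Sum>c\<in>S. vfield i c z * partial c F z)"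
proof -
  define U where "U = {J. partial (Der J) F \<noteq> (\<lambda>_. 0)}"
  have "Der ` U \<subseteq> S"
    using partial_outside[OF assms(2)] by (auto simp: U_def)
  then have fin: "finite U"
    using assms(1) by (meson finite_imageD finite_subset coord.inject(2) inj_onI)
  have "(\<Sum>c\<in>S. vfield i c z * partial c F z) = (\<Sum>c\<in>S \<union> insert (Ind i) (Der ` U). vfield i c z * partial c F z)"
    using assms(1) fin by (intro sum.mono_neutral_left) (auto simp: partial_outside[OF assms(2)])
  also have "\<dots> = (\<Sum>c\<in>insert (Ind i) (Der ` U). vfield i c z * partial c F z)"
  proof (intro sum.mono_neutral_right ballI)
    fix c assume "c \<in> S \<union> insert (Ind i) (Der ` U) - insert (Ind i) (Der ` U)"
    then show "vfield i c z * partial c F z = 0"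
      by (cases c) (auto simp: U_def)
  qed (use assms(1) fin in auto)
  also have "\<dots> = partial (Ind i) F z + (\<Sum>c\<in>Der ` U. vfield i c z * partial c F z)"
    using fin by (subst sum.insert) auto
  also have "(\<Sum>c\<in>Der ` U. vfield i c z * partial c F z) = (\<Sum>J\<in>U. z (Der (add_mset i J)) * partial (Der J) F z)"
    by (subst sum.reindex) (auto intro: inj_onI)
  finally show ?thesis by (simp add: total_deriv_def U_def)
qed

lemma diff_fun_total_deriv: assumes "diff_fun F" shows "diff_fun (total_deriv i F)"
proof -
  obtain S where S: "smooth F" "finite S" "depends_only S F" using assms(1) by (rule diff_funE)
  have "total_deriv i F = (\<lambda>z. \<Sum>c\<in>S. vfield i c z * partial c F z)"
    by (rule ext) (rule total_deriv_eq_sum[OF S(2,3)])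
  moreover have "diff_fun (\<lambda>z. \<Sum>c\<in>S. vfield i c z * partial c F z)"
    by (intro diff_fun_sum diff_fun_mult diff_fun_vfield diff_fun_partial assms)
  ultimately show ?thesis by (simp only:)
qed

text \<open>
  Along the straight line in the direction of the vector field the total derivative is an ordinary
  derivative, so the usual rules for sums, products and compositions carry over at once.
\<close>

lemma total_deriv_line:
  assumes "diff_fun F"
  shows "((\<lambda>s. F (\<lambda>c. z c + s * vfield i c z)) has_real_derivative total_deriv i F z) (at 0)"
proof -
  obtain S where S: "smooth F" "finite S" "depends_only S F" using assms(1) by (rule diff_funE)
  have "((\<lambda>s. F (\<lambda>c. z c + s * vfield i c z)) has_real_derivative
      (\<Sum>c\<in>S. partial c F (\<lambda>c. z c + 0 * vfield i c z) * vfield i c z)) (at 0)"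
    by (rule smooth_chain_rule[OF S, of "\<lambda>c s. z c + s * vfield i c z"])
      (auto intro!: derivative_eq_intros)
  then show ?thesis by (simp add: total_deriv_eq_sum[OF S(2,3)] mult.commute)
qed

lemma total_deriv_eqI:
  assumes "diff_fun F" "((\<lambda>s. F (\<lambda>c. z c + s * vfield i c z)) has_real_derivative D) (at 0)"
  shows "total_deriv i F z = D"
  using DERIV_unique[OF total_deriv_line[OF assms(1)] assms(2)] .

lemma total_deriv_const [simp]: "total_deriv i (\<lambda>_. k) z = 0"
  by (rule total_deriv_eqI[OF diff_fun_const]) simp

lemma total_deriv_coord [simp]: "total_deriv i (\<lambda>z. z c) z = vfield i c z"
  by (rule total_deriv_eqI[OF diff_fun_coord]) (auto intro!: derivative_eq_intros)

lemma total_deriv_add: "diff_fun F \<Longrightarrow> diff_fun G \<Longrightarrow>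
    total_deriv i (\<lambda>z. F z + G z) z = total_deriv i F z + total_deriv i G z"
  by (rule total_deriv_eqI) (auto intro!: diff_fun_intros DERIV_add total_deriv_line)

lemma total_deriv_diff: "diff_fun F \<Longrightarrow> diff_fun G \<Longrightarrow>
    total_deriv i (\<lambda>z. F z - G z) z = total_deriv i F z - total_deriv i G z"
  by (rule total_deriv_eqI) (auto intro!: diff_fun_intros DERIV_diff total_deriv_line)

lemma total_deriv_uminus: "diff_fun F \<Longrightarrow> total_deriv i (\<lambda>z. - F z) z = - total_deriv i F z"
  by (rule total_deriv_eqI) (auto intro!: diff_fun_intros DERIV_minus total_deriv_line)

lemma total_deriv_mult:
  assumes "diff_fun F" "diff_fun G"
  shows "total_deriv i (\<lambda>z. F z * G z) z = total_deriv i F z * G z + F z * total_deriv i G z"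
  using DERIV_mult'[OF total_deriv_line[OF assms(1), of z i] total_deriv_line[OF assms(2), of z i]] assms
  by (intro total_deriv_eqI) (auto intro!: diff_fun_intros simp: add.commute)

lemma total_deriv_cmult: "diff_fun F \<Longrightarrow> total_deriv i (\<lambda>z. k * F z) z = k * total_deriv i F z"
  using total_deriv_mult[OF diff_fun_const] by simp

lemma total_deriv_sum:
  assumes "\<And>j. j \<in> A \<Longrightarrow> diff_fun (F j)"
  shows "total_deriv i (\<lambda>z. \<Sum>j\<in>A. F j z) z = (\<Sum>j\<in>A. total_deriv i (F j) z)"
  using assms
  by (induction A rule: infinite_finite_induct) (auto simp: total_deriv_add diff_fun_sum)

lemma total_deriv_real_coord:
  assumes "smooth_real h"
  shows "total_deriv i (\<lambda>z. h (z c)) z = deriv h (z c) * vfield i c z"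
proof (rule total_deriv_eqI[OF diff_fun_real_coord[OF assms]])
  have "h differentiable at (z c)" using assms unfolding smooth_real_def by (metis funpow_0)
  then have "(h has_real_derivative deriv h (z c)) (at (z c + 0 * vfield i c z))"
    by (simp add: DERIV_deriv_iff_real_differentiable)
  moreover have "((\<lambda>s. z c + s * vfield i c z) has_real_derivative vfield i c z) (at 0)"
    by (auto intro!: derivative_eq_intros)
  ultimately show "((\<lambda>s. h (z c + s * vfield i c z)) has_real_derivative deriv h (z c) * vfield i c z) (at 0)"
    by (intro DERIV_chain')
qed

lemma total_deriv_compose:
  assumes F: "diff_fun F" and S: "finite S" "depends_only S F" and g: "\<And>c. diff_fun (g c)"
  shows "total_deriv i (\<lambda>z. F (\<lambda>c. g c z)) z =
    (\<Sum>c\<in>S. total_deriv i (g c) z * partial c F (\<lambda>c. g c z))"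
proof (rule total_deriv_eqI[OF diff_fun_compose[OF F g]])
  have "smooth F" using F by (simp add: diff_fun_def)
  from smooth_chain_rule[OF this S total_deriv_line[OF g]]
  show "((\<lambda>s. F (\<lambda>c. g c (\<lambda>c. z c + s * vfield i c z))) has_real_derivative
     (\<Sum>c\<in>S. total_deriv i (g c) z * partial c F (\<lambda>c. g c z))) (at 0)"
    by (simp add: mult.commute)
qed

lemma partial_add: "diff_fun F \<Longrightarrow> diff_fun G \<Longrightarrow> partial c (\<lambda>z. F z + G z) z = partial c F z + partial c G z"
  by (rule partial_eqI) (auto intro!: DERIV_add smooth_has_partial' simp: diff_fun_def)

lemma partial_mult:
  "diff_fun F \<Longrightarrow> diff_fun G \<Longrightarrow> partial c (\<lambda>z. F z * G z) z = partial c F z * G z + F z * partial c G z"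
  using DERIV_mult'[OF smooth_has_partial'[of F z c] smooth_has_partial'[of G z c]]
  by (intro partial_eqI) (auto simp: diff_fun_def add.commute)

lemma partial_const [simp]: "partial c (\<lambda>_. k) z = 0"
  by (rule partial_eqI) simp

lemma partial_coord: "partial c (\<lambda>z. z d) z = (if d = c then 1 else 0)"
  by (rule partial_eqI) (rule coordinate_line_derivative)

lemma partial_sum:
  "(\<And>i. i \<in> A \<Longrightarrow> diff_fun (F i)) \<Longrightarrow> partial c (\<lambda>z. \<Sum>i\<in>A. F i z) z = (\<Sum>i\<in>A. partial c (F i) z)"
  by (induction A rule: infinite_finite_induct) (auto simp: partial_add diff_fun_sum)

lemma partial_vfield:
  "partial d (vfield i c) z = (if \<exists>J. c = Der J \<and> d = Der (add_mset i J) then 1 else 0)"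
proof (cases c)
  case (Ind k)
  then have "vfield i c = (\<lambda>_. if k = i then 1 else 0)" by auto
  then show ?thesis using Ind by simp
next
  case (Der J)
  then have "vfield i c = (\<lambda>z. z (Der (add_mset i J)))" by auto
  then show ?thesis using Der by (auto simp: partial_coord)
qed

lemma partial_total_deriv_sum:
  assumes F: "diff_fun F" and S: "finite S" "depends_only S F"
  shows "partial d (total_deriv i F) z =
    total_deriv i (partial d F) z + (\<Sum>c\<in>S. partial d (vfield i c) z * partial c F z)"
proof -
  have eq: "total_deriv i F = (\<lambda>z. \<Sum>c\<in>S. vfield i c z * partial c F z)"
    using total_deriv_eq_sum[OF S] by blast
  have "partial d (total_deriv i F) z = (\<Sum>c\<in>S. partial d (vfield i c) z * partial c F z
      + vfield i c z * partial d (partial c F) z)"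
    unfolding eq by (simp add: partial_sum partial_mult diff_fun_mult diff_fun_vfield diff_fun_partial[OF F])
  also have "(\<Sum>c\<in>S. partial d (vfield i c) z * partial c F z + vfield i c z * partial d (partial c F) z)
     = total_deriv i (partial d F) z + (\<Sum>c\<in>S. partial d (vfield i c) z * partial c F z)"
    unfolding sum.distrib total_deriv_eq_sum[OF S(1) depends_only_partial[OF S(2)]]
      partial_commute[OF conjunct1[OF F[unfolded diff_fun_def]], of d]
    by (rule add.commute)
  finally show ?thesis .
qed

text \<open>
  The commutator of a total derivative with a jet derivative. The second summand comes from the
  coefficient \<open>u\<^bsub>J'+i\<^esub>\<close> of the vector field.
\<close>

lemma partial_Der_total_deriv:
  assumes "diff_fun F"
  shows "partial (Der J) (total_deriv i F) z = total_deriv i (partial (Der J) F) z +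
    (if i \<in># J then partial (Der (J - {#i#})) F z else 0)"
proof -
  obtain S where S: "smooth F" "finite S" "depends_only S F" using assms(1) by (rule diff_funE)
  let ?S = "insert (Der (J - {#i#})) S"
  have "(\<Sum>c\<in>?S. partial (Der J) (vfield i c) z * partial c F z)
    = (\<Sum>c\<in>?S. if c = Der (J - {#i#}) then (if i \<in># J then partial c F z else 0) else 0)"
    by (intro sum.cong refl) (auto simp: partial_vfield)
  also have "\<dots> = (if i \<in># J then partial (Der (J - {#i#})) F z else 0)"
    using S(2) by (subst sum.delta) auto
  finally have eq: "(\<Sum>c\<in>?S. partial (Der J) (vfield i c) z * partial c F z)
    = (if i \<in># J then partial (Der (J - {#i#})) F z else 0)" .
  have "finite ?S" "depends_only ?S F"
    using S(2) depends_only_mono[OF S(3) subset_insertI] by auto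
  from partial_total_deriv_sum[OF assms this, of "Der J" i z] show ?thesis unfolding eq .
qed

text \<open>
  Both orders give the same second derivative terms by Schwarz, and the coefficients of the two
  vector fields have matching derivatives since mixed derivatives of \<open>u\<close> are indexed by
  multisets.
\<close>

lemma total_deriv_commute:
  assumes "diff_fun F"
  shows "total_deriv i (total_deriv j F) = total_deriv j (total_deriv i F)"
proof
  fix z
  obtain S where S: "smooth F" "finite S" "depends_only S F" using assms(1) by (rule diff_funE)
  have expand: "total_deriv i (total_deriv j F) z = (\<Sum>c\<in>S. total_deriv i (vfield j c) z * partial c F z)
     + (\<Sum>c\<in>S. \<Sum>d\<in>S. vfield j c z * vfield i d z * partial d (partial c F) z)" for i j
  proof -
    have eq: "total_deriv j F = (\<lambda>z. \<Sum>c\<in>S. vfield j c z * partial c F z)"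
      using total_deriv_eq_sum[OF S(2,3)] by blast
    have "total_deriv i (total_deriv j F) z = (\<Sum>c\<in>S. total_deriv i (vfield j c) z * partial c F z
        + vfield j c z * total_deriv i (partial c F) z)"
      unfolding eq
      by (simp add: total_deriv_sum total_deriv_mult diff_fun_mult diff_fun_vfield diff_fun_partial[OF assms])
    then show ?thesis
      by (simp add: sum.distrib total_deriv_eq_sum[OF S(2) depends_only_partial[OF S(3)]]
          sum_distrib_left mult.assoc)
  qed
  have "total_deriv i (vfield j c) z = total_deriv j (vfield i c) z" for c
  proof (cases c)
    case (Ind k)
    then have "vfield j c = (\<lambda>_. if k = j then 1 else 0)" "vfield i c = (\<lambda>_. if k = i then 1 else 0)" by auto
    then show ?thesis by simp
  next
    case (Der J)
    then have "vfield j c = (\<lambda>z. z (Der (add_mset j J)))" "vfield i c = (\<lambda>z. z (Der (add_mset i J)))" by auto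
    then show ?thesis by (simp add: add_mset_commute)
  qed
  moreover have "(\<Sum>c\<in>S. \<Sum>d\<in>S. vfield j c z * vfield i d z * partial d (partial c F) z)
     = (\<Sum>c\<in>S. \<Sum>d\<in>S. vfield i c z * vfield j d z * partial d (partial c F) z)"
    by (subst sum.swap, intro sum.cong refl, subst partial_commute[OF S(1)]) (simp only: mult_ac)
  ultimately show "total_deriv i (total_deriv j F) z = total_deriv j (total_deriv i F) z"
    by (simp add: expand)
qed

section \<open>Iterated total derivatives\<close>

text \<open>
  Commutation of total derivatives rests on smoothness, so the iterate indexed by a multiset
  is taken along some enumeration; on differential functions the choice is immaterial.
\<close>

definition total_derivs :: "'n ivar multiset \<Rightarrow> ('n jet \<Rightarrow> real) \<Rightarrow> 'n jet \<Rightarrow> real" where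
  "total_derivs M F = foldr total_deriv (SOME l. mset l = M) F"

lemma diff_fun_foldr: "diff_fun F \<Longrightarrow> diff_fun (foldr total_deriv l F)"
  by (induction l) (auto intro: diff_fun_total_deriv)

lemma foldr_total_deriv_permute:
  assumes "diff_fun F" "mset l = mset l'"
  shows "foldr total_deriv l F = foldr total_deriv l' F"
  unfolding foldr_conv_fold
  by (rule fold_permuted_eq[where P = diff_fun])
    (use assms in \<open>auto intro: diff_fun_total_deriv total_deriv_commute\<close>)

lemma foldr_eq_total_derivs: "diff_fun F \<Longrightarrow> foldr total_deriv l F = total_derivs (mset l) F"
  unfolding total_derivs_def
  by (rule foldr_total_deriv_permute) (simp_all add: someI[of "\<lambda>l'. mset l' = mset l" l])

lemma diff_fun_total_derivs: "diff_fun F \<Longrightarrow> diff_fun (total_derivs M F)"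
  unfolding total_derivs_def by (rule diff_fun_foldr)

lemma total_derivs_empty [simp]: "total_derivs {#} F = F"
  by (simp add: total_derivs_def)

lemma total_derivs_add_mset: assumes "diff_fun F" shows "total_derivs (add_mset i M) F = total_deriv i (total_derivs M F)"
proof -
  obtain l where l: "mset l = M" using ex_mset by blast
  have "total_derivs (add_mset i M) F = foldr total_deriv (i # l) F"
    using foldr_eq_total_derivs[OF assms, of "i # l"] l by simp
  then show ?thesis using foldr_eq_total_derivs[OF assms, of l] l by simp
qed

lemma total_derivs_of_total_deriv: assumes "diff_fun F" shows "total_derivs M (total_deriv i F) = total_deriv i (total_derivs M F)"
  using assms
  by (induction M) (simp_all add: total_derivs_add_mset diff_fun_total_deriv total_deriv_commute[of "total_derivs _ F"] diff_fun_total_derivs)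

lemma total_derivs_coord: "total_derivs M (\<lambda>z. z (Der J)) = (\<lambda>z. z (Der (M + J)))"
  by (induction M) (auto simp: total_derivs_add_mset diff_fun_coord)

lemma total_derivs_linear:
  assumes "\<And>j. j \<in> A \<Longrightarrow> diff_fun (F j)"
  shows "total_derivs M (\<lambda>z. \<Sum>j\<in>A. k j * F j z) z = (\<Sum>j\<in>A. k j * total_derivs M (F j) z)"
proof (induction M arbitrary: z)
  case (add i M)
  have eq: "total_derivs M (\<lambda>z. \<Sum>j\<in>A. k j * F j z) = (\<lambda>z. \<Sum>j\<in>A. k j * total_derivs M (F j) z)"
    using add by blast
  have "total_derivs (add_mset i M) (\<lambda>z. \<Sum>j\<in>A. k j * F j z) z = total_deriv i (\<lambda>z. \<Sum>j\<in>A. k j * total_derivs M (F j) z) z"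
    using assms by (simp add: eq total_derivs_add_mset diff_fun_sum diff_fun_mult diff_fun_const)
  also have "\<dots> = (\<Sum>j\<in>A. k j * total_derivs (add_mset i M) (F j) z)"
    using assms by (simp add: total_deriv_sum total_deriv_cmult total_derivs_add_mset diff_fun_total_derivs diff_fun_mult diff_fun_const)
  finally show ?case .
qed simp

lemma total_derivs_add: "diff_fun F \<Longrightarrow> diff_fun G \<Longrightarrow> total_derivs M (\<lambda>z. F z + G z) z = total_derivs M F z + total_derivs M G z"
  using total_derivs_linear[of "{False, True}" "\<lambda>b. if b then G else F" M "\<lambda>_. 1" z] by auto

lemma total_derivs_cmult: "diff_fun F \<Longrightarrow> total_derivs M (\<lambda>z. k * F z) z = k * total_derivs M F z"
  using total_derivs_linear[of "{()}" "\<lambda>_. F" M "\<lambda>_. k" z] by simp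

lemma total_derivs_zero [simp]: "total_derivs M (\<lambda>_. 0) z = 0"
  using total_derivs_linear[of "{}" undefined M undefined z] by simp

section \<open>Weights of jet coordinates\<close>

text \<open>
  Assigning weights to the independent variables grades the jet coordinates. Two gradings are used:
  the number of \<open>t\<close>-derivatives, and the one that singles out the leading terms of the
  multiplier.
\<close>

fun weight :: "('n ivar \<Rightarrow> nat) \<Rightarrow> 'n coord \<Rightarrow> nat" where
  "weight \<omega> (Ind k) = 0"
| "weight \<omega> (Der J) = (\<Sum>i\<in>#J. \<omega> i)"

abbreviation weight_le :: "('n ivar \<Rightarrow> nat) \<Rightarrow> nat \<Rightarrow> ('n jet \<Rightarrow> real) \<Rightarrow> bool" where
  "weight_le \<omega> m \<equiv> depends_only {c. weight \<omega> c \<le> m}"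

lemma weight_le_mono: "weight_le \<omega> m F \<Longrightarrow> m \<le> m' \<Longrightarrow> weight_le \<omega> m' F"
  by (erule depends_only_mono) auto

lemma weight_le_vfield: "weight_le \<omega> (weight \<omega> c + \<omega> i) (vfield i c)"
  by (cases c) (auto simp: depends_only_def)

lemma depends_only_const: "depends_only S (\<lambda>_. k)" by (simp add: depends_only_def)

lemma depends_only_coord: "c \<in> S \<Longrightarrow> depends_only S (\<lambda>z. z c)" by (simp add: depends_only_def)

lemma depends_only_add: "depends_only S F \<Longrightarrow> depends_only S G \<Longrightarrow> depends_only S (\<lambda>z. F z + G z)"
  unfolding depends_only_def by metis

lemma depends_only_diff: "depends_only S F \<Longrightarrow> depends_only S G \<Longrightarrow> depends_only S (\<lambda>z. F z - G z)"
  unfolding depends_only_def by metis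

lemma depends_only_uminus: "depends_only S F \<Longrightarrow> depends_only S (\<lambda>z. - F z)"
  unfolding depends_only_def by metis

lemma depends_only_mult: "depends_only S F \<Longrightarrow> depends_only S G \<Longrightarrow> depends_only S (\<lambda>z. F z * G z)"
  unfolding depends_only_def by metis

lemma depends_only_sum:
  "(\<And>i. i \<in> A \<Longrightarrow> depends_only S (F i)) \<Longrightarrow> depends_only S (\<lambda>z. \<Sum>i\<in>A. F i z)"
  unfolding depends_only_def by (intro allI impI sum.cong refl) blast

lemma weight_le_total_deriv:
  assumes "diff_fun F" "weight_le \<omega> m F"
  shows "weight_le \<omega> (m + \<omega> i) (total_deriv i F)"
proof -
  obtain S where S: "smooth F" "finite S" "S \<subseteq> {c. weight \<omega> c \<le> m}" "depends_only S F"
    using assms by (rule diff_funE')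
  have "total_deriv i F = (\<lambda>z. \<Sum>c\<in>S. vfield i c z * partial c F z)"
    using total_deriv_eq_sum[OF S(2,4)] by blast
  moreover have "weight_le \<omega> (m + \<omega> i) (\<lambda>z. \<Sum>c\<in>S. vfield i c z * partial c F z)"
  proof (intro depends_only_sum depends_only_mult)
    fix c assume "c \<in> S"
    then show "weight_le \<omega> (m + \<omega> i) (vfield i c)"
      using S(3) by (intro weight_le_mono[OF weight_le_vfield]) auto
    show "weight_le \<omega> (m + \<omega> i) (partial c F)"
      by (rule weight_le_mono[OF depends_only_partial[OF assms(2)]]) simp
  qed
  ultimately show ?thesis by simp
qed

lemma weight_le_total_derivs:
  assumes "diff_fun F" "weight_le \<omega> m F"
  shows "weight_le \<omega> (m + (\<Sum>i\<in>#M. \<omega> i)) (total_derivs M F)"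
proof (induction M)
  case (add i M)
  then show ?case
    using weight_le_total_deriv[OF diff_fun_total_derivs[OF assms(1)] add, of i]
    by (simp add: total_derivs_add_mset[OF assms(1)] add_ac)
qed (use assms in simp)

section \<open>Total divergences\<close>

lemma finite_ivars: "finite (UNIV :: 'n::finite ivar set)"
proof -
  have "UNIV = insert VX (insert VT (range (VY :: 'n \<Rightarrow> 'n ivar)))"
    using ivar.exhaust by auto
  then show ?thesis by (metis finite_imageI finite_insert finite)
qed

lemma total_div_eq_sum:
  fixes P :: "'n::finite current"
  shows "total_div P z = (\<Sum>i\<in>UNIV. total_deriv i (P i) z)"
proof -
  have U: "(UNIV :: 'n ivar set) = insert VT (insert VX (range VY))"
    using ivar.exhaust by auto
  have "(\<Sum>i\<in>range VY. total_deriv i (P i) z) = (\<Sum>j\<in>UNIV. total_deriv (VY j) (P (VY j)) z)"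
    by (subst sum.reindex) (auto intro: inj_onI)
  moreover have "(\<Sum>i\<in>insert VT (insert VX (range VY)). total_deriv i (P i) z) =
      total_deriv VT (P VT) z + (total_deriv VX (P VX) z + (\<Sum>i\<in>range VY. total_deriv i (P i) z))"
    by (subst sum.insert, simp, force, subst sum.insert) auto
  ultimately show ?thesis unfolding U total_div_def by simp
qed

lemma total_div_add:
  fixes P Q :: "'n::finite current"
  assumes "\<And>i. diff_fun (P i)" "\<And>i. diff_fun (Q i)"
  shows "total_div (\<lambda>i z. P i z + Q i z) z = total_div P z + total_div Q z"
  using assms by (simp add: total_div_eq_sum total_deriv_add sum.distrib)

lemma total_div_diff:
  fixes P Q :: "'n::finite current"
  assumes "\<And>i. diff_fun (P i)" "\<And>i. diff_fun (Q i)"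
  shows "total_div (\<lambda>i z. P i z - Q i z) z = total_div P z - total_div Q z"
  using assms by (simp add: total_div_eq_sum total_deriv_diff sum_subtractf)

lemma total_div_single:
  fixes F :: "'n::finite jet \<Rightarrow> real"
  shows "total_div (\<lambda>j. if j = i then F else (\<lambda>_. 0)) z = total_deriv i F z"
proof -
  have "total_deriv j (if j = i then F else (\<lambda>_. 0)) z = (if j = i then total_deriv i F z else 0)" for j
    by simp
  then show ?thesis by (simp add: total_div_eq_sum finite_ivars)
qed

section \<open>Equations solved for a third time derivative\<close>

definition t_weight :: "'n ivar \<Rightarrow> nat" where
  "t_weight i = (if i = VT then 1 else 0)"

abbreviation ttt :: "'n ivar multiset" where "ttt \<equiv> {#VT, VT, VT#}"

text \<open>
  Functions of the coordinates with at most two \<open>t\<close>-derivatives, which parametrise the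
  solutions of an equation solved for \<open>u\<^bsub>ttt\<^esub>\<close>.
\<close>

abbreviation low_order :: "('n jet \<Rightarrow> real) \<Rightarrow> bool" where
  "low_order \<equiv> weight_le t_weight 2"

lemma sum_t_weight: "(\<Sum>i\<in>#J. t_weight i) = count J VT"
  by (induction J) (auto simp: t_weight_def)

lemma weight_t_weight: "weight t_weight (Der J) = count J VT"
  by (simp add: sum_t_weight)

lemma split_ttt: "3 \<le> count J VT \<Longrightarrow> (J - ttt) + ttt = J"
  by (intro multiset_eqI) auto

lemma depends_only_UNIV: "depends_only UNIV F"
  unfolding depends_only_def using ext by (metis UNIV_I)

text \<open>
  An equation \<open>E = 0\<close> that can be solved for \<open>u\<^bsub>ttt\<^esub>\<close>, with a right-hand side \<open>H\<close> in
  which at most two \<open>t\<close>-derivatives occur. Such an equation has no hidden integrability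
  conditions: its prolongation is a graph over the coordinates of low order.
\<close>

locale normal_form =
  fixes E H :: "'n::finite jet \<Rightarrow> real" and a :: real
  assumes E_eq: "\<And>z. E z = a * (z (Der ttt) - H z)" and a_nz: "a \<noteq> 0"
    and diff_fun_H: "diff_fun H" and low_order_H: "low_order H"
begin

lemma diff_fun_E: "diff_fun E"
proof -
  have "diff_fun (\<lambda>z. a * (z (Der ttt) - H z))"
    by (intro diff_fun_mult diff_fun_const diff_fun_diff diff_fun_coord diff_fun_H)
  moreover have "E = (\<lambda>z. a * (z (Der ttt) - H z))" using E_eq by (rule ext)
  ultimately show ?thesis by simp
qed

lemma total_derivs_E: "total_derivs M E z = a * (z (Der (M + ttt)) - total_derivs M H z)"
proof -
  have "E = (\<lambda>z. a * (z (Der ttt) + (-1) * H z))" using E_eq by (intro ext) simp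
  then have "total_derivs M E z = a * total_derivs M (\<lambda>z. z (Der ttt) + (-1) * H z) z"
    using total_derivs_cmult[of "\<lambda>z. z (Der ttt) + (-1) * H z" M a z]
    by (simp only: diff_fun_add diff_fun_mult diff_fun_const diff_fun_coord diff_fun_H)
  also have "total_derivs M (\<lambda>z. z (Der ttt) + (-1) * H z) z = z (Der (M + ttt)) + (-1) * total_derivs M H z"
    by (subst total_derivs_add) (simp_all add: diff_fun_coord diff_fun_uminus diff_fun_H total_derivs_coord
        total_derivs_cmult[OF diff_fun_H, of M "-1", simplified])
  finally show ?thesis by simp
qed

lemma total_derivs_H_weight: "weight_le t_weight (2 + count M VT) (total_derivs M H)"
  using weight_le_total_derivs[OF diff_fun_H low_order_H, of M] by (simp add: sum_t_weight)

lemma prolongation_iff: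
  "z \<in> prolongation E \<longleftrightarrow> (\<forall>J. 3 \<le> count J VT \<longrightarrow> z (Der J) = total_derivs (J - ttt) H z)"
proof
  assume z: "z \<in> prolongation E"
  show "\<forall>J. 3 \<le> count J VT \<longrightarrow> z (Der J) = total_derivs (J - ttt) H z"
  proof (intro allI impI)
    fix J :: "'n ivar multiset" assume J: "3 \<le> count J VT"
    obtain l where l: "mset l = J - ttt" using ex_mset by blast
    have "foldr total_deriv l E z = 0" using z unfolding prolongation_def by blast
    then have "total_derivs (J - ttt) E z = 0" unfolding foldr_eq_total_derivs[OF diff_fun_E] l .
    then show "z (Der J) = total_derivs (J - ttt) H z" using a_nz unfolding total_derivs_E split_ttt[OF J] by simp
  qed
next
  assume R: "\<forall>J. 3 \<le> count J VT \<longrightarrow> z (Der J) = total_derivs (J - ttt) H z"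
  have "total_derivs M E z = 0" for M using R[rule_format, of "M + ttt"] by (simp add: total_derivs_E)
  then show "z \<in> prolongation E" by (simp add: prolongation_def foldr_eq_total_derivs[OF diff_fun_E])
qed

text \<open>
  The retraction of the jet space onto the prolongation that keeps the coordinates of low order. A
  coordinate with more \<open>t\<close>-derivatives is computed from the differentiated equation
  \<open>u\<^bsub>ttt+K\<^esub> = D\<^sub>K H\<close>, whose right-hand side has fewer of them. The cut-off to lower
  coordinates makes the recursion visibly terminate, and \<open>retract_high\<close> removes it.
\<close>

function retract :: "'n jet \<Rightarrow> 'n coord \<Rightarrow> real" where
  "retract z c = (if weight t_weight c \<le> 2 then z c else
     (case c of Ind k \<Rightarrow> 0 | Der J \<Rightarrow>
       total_derivs (J - ttt) H (\<lambda>d. if weight t_weight d < weight t_weight c then retract z d else 0)))"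
  by auto
termination by (relation "Wellfounded.measure (\<lambda>(z, c). weight t_weight c)") auto

declare retract.simps [simp del]

lemma retract_low: "weight t_weight c \<le> 2 \<Longrightarrow> retract z c = z c"
  unfolding retract.simps[of z c] by (simp only: if_True)

lemma retract_high_cut:
  assumes "3 \<le> count J VT"
  shows "retract z (Der J) = total_derivs (J - ttt) H (\<lambda>d. if weight t_weight d < count J VT then retract z d else 0)"
proof -
  have "retract z (Der J) = (if weight t_weight (Der J) \<le> 2 then z (Der J) else
     total_derivs (J - ttt) H (\<lambda>d. if weight t_weight d < weight t_weight (Der J) then retract z d else 0))"
    by (rule trans[OF retract.simps[of z "Der J"]]) (simp only: coord.case)
  moreover have "\<not> count J VT \<le> 2" using assms by simp
  ultimately show ?thesis by (simp only: weight_t_weight if_False)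
qed

lemma total_derivs_H_cong:
  assumes "3 \<le> count J VT" "\<And>d. weight t_weight d < count J VT \<Longrightarrow> z d = w d"
  shows "total_derivs (J - ttt) H z = total_derivs (J - ttt) H w"
  by (rule depends_onlyD[OF total_derivs_H_weight]) (use assms in auto)

lemma retract_high:
  assumes "3 \<le> count J VT"
  shows "retract z (Der J) = total_derivs (J - ttt) H (retract z)"
  unfolding retract_high_cut[OF assms] by (rule total_derivs_H_cong[OF assms]) simp

lemma retract_on_shell: "retract z \<in> prolongation E"
  by (simp add: prolongation_iff retract_high)

lemma retract_low_order: "low_order F \<Longrightarrow> F (retract z) = F z"
  by (erule depends_onlyD) (simp add: retract_low)

lemma coord_cases:
  obtains (low) "weight t_weight c \<le> 2" | (high) J where "c = Der J" "3 \<le> count J VT"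
proof (cases c)
  case (Der J)
  then show ?thesis using that weight_t_weight[of J] by (cases "count J VT \<le> 2") auto
qed (use that in auto)

lemma retract_id: assumes z: "z \<in> prolongation E" shows "retract z = z"
proof
  fix c show "retract z c = z c"
  proof (induction "weight t_weight c" arbitrary: c rule: less_induct)
    case less
    show ?case
    proof (cases c rule: coord_cases)
      case (high J)
      have "total_derivs (J - ttt) H (retract z) = total_derivs (J - ttt) H z"
        by (rule total_derivs_H_cong[OF high(2)]) (use less high weight_t_weight[of J] in auto)
      then show ?thesis using z high by (simp add: retract_high prolongation_iff)
    qed (rule retract_low)
  qed
qed

lemma retract_component: "diff_fun (\<lambda>z. retract z c) \<and> low_order (\<lambda>z. retract z c)"
proof (induction "weight t_weight c" arbitrary: c rule: less_induct)
  case less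
  show ?case
  proof (cases c rule: coord_cases)
    case low
    then have "(\<lambda>z. retract z c) = (\<lambda>z. z c)" by (simp add: retract_low)
    then show ?thesis using low by (simp add: diff_fun_coord depends_only_coord)
  next
    case (high J)
    define g where "g = (\<lambda>d z. if weight t_weight d < count J VT then retract z d else 0)"
    have eq: "(\<lambda>z. retract z c) = (\<lambda>z. total_derivs (J - ttt) H (\<lambda>d. g d z))"
      using high retract_high_cut by (auto simp: g_def)
    have g: "diff_fun (g d) \<and> low_order (g d)" for d
      using less[of d] high weight_t_weight[of J]
      by (cases "weight t_weight d < count J VT") (simp_all add: g_def diff_fun_const depends_only_const)
    have "diff_fun (\<lambda>z. total_derivs (J - ttt) H (\<lambda>d. g d z))"
      by (rule diff_fun_compose[where g = g, OF diff_fun_total_derivs[OF diff_fun_H] g[THEN conjunct1]])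
    moreover have "low_order (\<lambda>z. total_derivs (J - ttt) H (\<lambda>d. g d z))"
      by (rule depends_only_compose[where g = g, OF depends_only_UNIV g[THEN conjunct2]])
    ultimately show ?thesis unfolding eq ..
  qed
qed

lemmas diff_fun_retract = retract_component[THEN conjunct1] and low_order_retract = retract_component[THEN conjunct2]

text \<open>
  The total derivative fields are tangent to the prolongation. For a principal coordinate this is
  the chain rule together with one more differentiation of the equation.
\<close>

lemma total_deriv_retract:
  assumes z: "z \<in> prolongation E"
  shows "total_deriv i (\<lambda>z. retract z c) z = vfield i c z"
proof (induction "weight t_weight c" arbitrary: c rule: less_induct)
  case less
  show ?case
  proof (cases c rule: coord_cases)
    case low
    then have "(\<lambda>z. retract z c) = (\<lambda>z. z c)" by (simp add: retract_low)
    then show ?thesis by simp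
  next
    case (high J)
    define K where "K = J - ttt"
    define g where "g = (\<lambda>d z. if weight t_weight d < count J VT then retract z d else 0)"
    have dH: "diff_fun (total_derivs K H)" by (rule diff_fun_total_derivs[OF diff_fun_H])
    have "weight_le t_weight (2 + count K VT) (total_derivs K H)" by (rule total_derivs_H_weight)
    with dH obtain S where S: "finite S" "S \<subseteq> {c. weight t_weight c \<le> 2 + count K VT}"
        "depends_only S (total_derivs K H)" by (rule diff_funE')
    have low: "weight t_weight d < count J VT" if "d \<in> S" for d
      using S(2) that high by (auto simp: K_def)
    have g: "g d = (\<lambda>z. retract z d)" if "d \<in> S" for d using low[OF that] by (simp add: g_def)
    have "(\<lambda>z. retract z c) = (\<lambda>z. total_derivs K H (\<lambda>d. g d z))"
      using high retract_high_cut by (auto simp: g_def K_def)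
    moreover have "diff_fun (g d)" for d
      using diff_fun_retract diff_fun_const[of 0]
      by (cases "weight t_weight d < count J VT") (simp_all add: g_def)
    ultimately have "total_deriv i (\<lambda>z. retract z c) z
        = (\<Sum>d\<in>S. total_deriv i (g d) z * partial d (total_derivs K H) (\<lambda>d. g d z))"
      by (simp add: total_deriv_compose[OF dH S(1,3)])
    also have "\<dots> = (\<Sum>d\<in>S. vfield i d z * partial d (total_derivs K H) z)"
    proof (intro sum.cong refl)
      fix d assume d: "d \<in> S"
      have "partial d (total_derivs K H) (\<lambda>d. g d z) = partial d (total_derivs K H) z"
        by (rule depends_onlyD[OF depends_only_partial[OF S(3)]]) (simp add: g retract_id[OF z])
      moreover have "total_deriv i (g d) z = vfield i d z"
        unfolding g[OF d] using less[of d] low[OF d] high weight_t_weight[of J] by simp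
      ultimately show "total_deriv i (g d) z * partial d (total_derivs K H) (\<lambda>d. g d z)
          = vfield i d z * partial d (total_derivs K H) z" by simp
    qed
    also have "\<dots> = total_deriv i (total_derivs K H) z" by (rule total_deriv_eq_sum[OF S(1,3), symmetric])
    also have "\<dots> = total_derivs (add_mset i K) H z" by (simp add: total_derivs_add_mset[OF diff_fun_H])
    also have "add_mset i K = add_mset i J - ttt"
    proof -
      have "add_mset i J = add_mset i K + ttt"
        using split_ttt[OF high(2)] unfolding K_def by (metis union_mset_add_mset_left)
      then show ?thesis by simp
    qed
    also have "total_derivs (add_mset i J - ttt) H z = z (Der (add_mset i J))"
      using z high by (simp add: prolongation_iff)
    finally show ?thesis using high by simp
  qed
qed

lemma total_deriv_on_shell:
  assumes "diff_fun F" "z \<in> prolongation E"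
  shows "total_deriv i (\<lambda>z. F (retract z)) z = total_deriv i F z"
proof -
  obtain S where S: "finite S" "depends_only S F" using assms(1) by (rule diff_funE)
  have "total_deriv i (\<lambda>z. F (\<lambda>c. retract z c)) z = (\<Sum>c\<in>S. total_deriv i (\<lambda>z. retract z c) z * partial c F (\<lambda>c. retract z c))"
    by (rule total_deriv_compose[OF assms(1) S diff_fun_retract])
  then show ?thesis
    by (simp add: total_deriv_retract[OF assms(2)] retract_id[OF assms(2)] total_deriv_eq_sum[OF S])
qed

text \<open>
  A function vanishes modulo the equation iff its composition with the retraction is zero, and by
  tangency total derivatives on the prolongation see only this composition.
\<close>

lemma vanishes_total_deriv:
  assumes "diff_fun F" "vanishes_mod E F"
  shows "vanishes_mod E (total_deriv i F)"
proof -
  have "(\<lambda>z. F (retract z)) = (\<lambda>_. 0)"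
    using assms(2) retract_on_shell by (auto simp: vanishes_mod_def)
  then show ?thesis
    using total_deriv_on_shell[OF assms(1), of _ i] by (simp add: vanishes_mod_def)
qed

lemma vanishes_total_derivs: "diff_fun F \<Longrightarrow> vanishes_mod E F \<Longrightarrow> vanishes_mod E (total_derivs M F)"
  by (induction M) (simp_all add: total_derivs_add_mset vanishes_total_deriv diff_fun_total_derivs)

lemma vanishes_E: "vanishes_mod E E"
proof -
  have "foldr total_deriv [] E z = 0" if "z \<in> prolongation E" for z
    using that unfolding prolongation_def by blast
  then show ?thesis by (simp add: vanishes_mod_def)
qed

section \<open>The characteristic form of a conservation law\<close>

text \<open>
  In such a decomposition of a divergence the coefficient \<open>\<Lambda>\<close> becomes the multiplier, while
  subtracting \<open>N\<close> changes the current by a trivial part only.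
\<close>

definition reducible :: "('n jet \<Rightarrow> real) \<Rightarrow> bool" where
  "reducible F \<longleftrightarrow> (\<exists>\<Lambda> N. diff_fun \<Lambda> \<and> low_order \<Lambda> \<and>
     (\<forall>i. diff_fun (N i) \<and> vanishes_mod E (N i)) \<and> (\<forall>z. F z = \<Lambda> z * E z + total_div N z))"

lemma reducibleI:
  assumes "diff_fun \<Lambda>" "low_order \<Lambda>" "\<And>i. diff_fun (N i)" "\<And>i. vanishes_mod E (N i)"
    "\<And>z. F z = \<Lambda> z * E z + total_div N z"
  shows "reducible F"
  unfolding reducible_def using assms by blast

lemma reducibleE:
  assumes "reducible F"
  obtains \<Lambda> N where "diff_fun \<Lambda>" "low_order \<Lambda>" "\<And>i. diff_fun (N i)" "\<And>i. vanishes_mod E (N i)"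
    "\<And>z. F z = \<Lambda> z * E z + total_div N z"
  using assms unfolding reducible_def by blast

lemma reducible_zero: "reducible (\<lambda>_. 0)"
  by (rule reducibleI[of "\<lambda>_. 0" "\<lambda>_ _. 0"])
    (auto simp: diff_fun_const depends_only_const vanishes_mod_def total_div_def)

lemma reducible_add:
  assumes "reducible F" "reducible G"
  shows "reducible (\<lambda>z. F z + G z)"
proof -
  obtain \<Lambda> N where 1: "diff_fun \<Lambda>" "low_order \<Lambda>" "\<And>i. diff_fun (N i)" "\<And>i. vanishes_mod E (N i)"
    "\<And>z. F z = \<Lambda> z * E z + total_div N z" using assms(1) by (rule reducibleE) blast
  obtain \<Lambda>' N' where 2: "diff_fun \<Lambda>'" "low_order \<Lambda>'" "\<And>i. diff_fun (N' i)" "\<And>i. vanishes_mod E (N' i)"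
    "\<And>z. G z = \<Lambda>' z * E z + total_div N' z" using assms(2) by (rule reducibleE) blast
  show ?thesis
  proof (rule reducibleI[of "\<lambda>z. \<Lambda> z + \<Lambda>' z" "\<lambda>i z. N i z + N' i z"])
    show "F z + G z = (\<Lambda> z + \<Lambda>' z) * E z + total_div (\<lambda>i z. N i z + N' i z) z" for z
      by (simp add: 1 2 total_div_add algebra_simps)
  qed (use 1 2 in \<open>auto intro: diff_fun_add depends_only_add simp: vanishes_mod_def\<close>)
qed

lemma reducible_sum:
  "finite A \<Longrightarrow> (\<And>j. j \<in> A \<Longrightarrow> reducible (F j)) \<Longrightarrow> reducible (\<lambda>z. \<Sum>j\<in>A. F j z)"
  by (induction A rule: finite_induct) (simp_all add: reducible_zero reducible_add)

text \<open>
  Integration by parts moves the derivatives from the equation to the coefficient. As none of them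
  is a \<open>t\<close>-derivative, the coefficient keeps its low order.
\<close>

lemma reducible_by_parts:
  assumes "VT \<notin># K" "diff_fun h" "low_order h"
  shows "reducible (\<lambda>z. h z * total_derivs K E z)"
  using assms
proof (induction K arbitrary: h)
  case empty
  then show ?case
    by (intro reducibleI[of h "\<lambda>_ _. 0"])
      (auto simp: diff_fun_const vanishes_mod_def total_div_def)
next
  case (add i K)
  let ?F = "\<lambda>z. h z * total_derivs K E z"
  have "t_weight i = 0" using add.prems(1) by (auto simp: t_weight_def)
  then have "low_order (total_deriv i h)"
    using weight_le_total_deriv[OF add.prems(2,3), of i] by simp
  then have "reducible (\<lambda>z. (- total_deriv i h z) * total_derivs K E z)"
    using add.prems by (intro add.IH diff_fun_uminus diff_fun_total_deriv depends_only_uminus) auto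
  moreover have F: "diff_fun ?F"
    by (intro diff_fun_mult add.prems diff_fun_total_derivs diff_fun_E)
  have "reducible (total_deriv i ?F)"
  proof (rule reducibleI[of "\<lambda>_. 0" "\<lambda>j. if j = i then ?F else (\<lambda>_. 0)"])
    show "vanishes_mod E (if j = i then ?F else (\<lambda>_. 0))" for j
      using vanishes_total_derivs[OF diff_fun_E vanishes_E, of K] by (simp add: vanishes_mod_def)
    show "diff_fun (if j = i then ?F else (\<lambda>_. 0))" for j
      using F by (simp add: diff_fun_const)
  qed (simp_all add: diff_fun_const depends_only_const total_div_single)
  ultimately have "reducible (\<lambda>z. (- total_deriv i h z) * total_derivs K E z + total_deriv i ?F z)"
    by (rule reducible_add)
  moreover have "(- total_deriv i h z) * total_derivs K E z + total_deriv i ?F z = h z * total_derivs (add_mset i K) E z" for z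
    using add.prems by (simp add: total_derivs_add_mset[OF diff_fun_E] total_deriv_mult diff_fun_total_derivs diff_fun_E)
  ultimately show ?case by simp
qed

text \<open>
  Every conservation law is equivalent to one whose divergence is a multiple of \<open>E\<close> identically,
  with a multiplier of low order. Composition with the retraction changes the current by a
  trivial part. Afterwards only \<open>D\<^sub>t \<rho>\<close> leaves the coordinates of low order, and it does so linearly
  in the derivatives \<open>u\<^bsub>ttt+K\<^esub>\<close>; the divergence vanishes on solutions, so it is a combination of
  the differences \<open>u\<^bsub>ttt+K\<^esub> - D\<^sub>K H\<close>, that is of \<open>D\<^sub>K E / a\<close>, where \<open>K\<close> contains no \<open>t\<close>.
\<close>

theorem characteristic_form:
  assumes P: "conservation_law E P"
  obtains \<Lambda> Q where "diff_fun \<Lambda>" "low_order \<Lambda>" "\<And>i. diff_fun (Q i)"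
    "\<And>i. vanishes_mod E (\<lambda>z. P i z - Q i z)" "\<And>z. total_div Q z = \<Lambda> z * E z"
proof -
  have dP: "diff_fun (P i)" for i using P by (simp add: conservation_law_def)
  \<comment> \<open>the current restricted to the prolongation and extended by the retraction\<close>
  define P' where "P' = (\<lambda>i z. P i (retract z))"
  have dP': "diff_fun (P' i)" for i
    unfolding P'_def using diff_fun_compose[OF dP diff_fun_retract] by simp
  have pP': "low_order (P' i)" for i
    unfolding P'_def using depends_only_compose[OF depends_only_UNIV low_order_retract, of "P i"] by simp
  define \<rho> where "\<rho> = P' VT"
  obtain S where S: "finite S" "S \<subseteq> {c. weight t_weight c \<le> 2}" "depends_only S \<rho>"
    using dP' pP' unfolding \<rho>_def by (rule diff_funE')
  \<comment> \<open>the coordinates whose \<open>t\<close>-derivative is no longer of low order\<close>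
  define T where "T = {J. Der J \<in> S \<and> count J VT = 2}"
  have "T \<subseteq> (\<lambda>c. case c of Der J \<Rightarrow> J) ` S" by (force simp: T_def)
  then have T: "finite T" "\<And>J. J \<in> T \<Longrightarrow> count J VT = 2"
    using S(1) finite_subset by (auto simp: T_def)
  have on_shell: "total_div P' z = 0" if "z \<in> prolongation E" for z
  proof -
    have "total_div P' z = total_div P z"
      using dP that by (simp add: total_div_eq_sum P'_def total_deriv_on_shell)
    then show ?thesis using P that by (simp add: conservation_law_def vanishes_mod_def)
  qed
  have div: "total_div P' z = (\<Sum>J\<in>T. (partial (Der J) \<rho> z / a) * total_derivs (J - {#VT, VT#}) E z)" for z
  proof -
    have other: "total_deriv i (P' i) (retract z) = total_deriv i (P' i) z" if "i \<noteq> VT" for i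
      using weight_le_total_deriv[OF dP' pP', of i i] that by (intro retract_low_order) (simp add: t_weight_def)
    have "total_div P' z = total_div P' z - total_div P' (retract z)"
      using on_shell[OF retract_on_shell] by simp
    also have "\<dots> = (\<Sum>i\<in>UNIV. total_deriv i (P' i) z - total_deriv i (P' i) (retract z))"
      by (simp add: total_div_eq_sum sum_subtractf)
    also have "\<dots> = (\<Sum>i\<in>(UNIV :: 'n ivar set). if i = VT then total_deriv VT \<rho> z - total_deriv VT \<rho> (retract z) else 0)"
      by (intro sum.cong) (auto simp: other \<rho>_def)
    also have "\<dots> = total_deriv VT \<rho> z - total_deriv VT \<rho> (retract z)"
      by (simp add: finite_ivars)
    also have "\<dots> = (\<Sum>c\<in>S. (vfield VT c z - vfield VT c (retract z)) * partial c \<rho> z)"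
      unfolding total_deriv_eq_sum[OF S(1) S(3)[unfolded \<rho>_def]] \<rho>_def left_diff_distrib sum_subtractf
        retract_low_order[OF depends_only_partial[OF pP'[of VT]]] ..
    also have "\<dots> = (\<Sum>c\<in>Der ` T. (vfield VT c z - vfield VT c (retract z)) * partial c \<rho> z)"
    proof (intro sum.mono_neutral_right ballI S(1))
      fix c assume c: "c \<in> S - Der ` T"
      show "(vfield VT c z - vfield VT c (retract z)) * partial c \<rho> z = 0"
      proof (cases c)
        case (Der J)
        then have "count J VT \<le> 1" using c S(2) weight_t_weight[of J] by (force simp: T_def)
        then have "weight t_weight (Der (add_mset VT J)) \<le> 2" unfolding weight_t_weight by simp
        then show ?thesis using Der by (simp add: retract_low)
      qed simp
    qed (auto simp: T_def)
    also have "\<dots> = (\<Sum>J\<in>T. (z (Der (add_mset VT J)) - retract z (Der (add_mset VT J))) * partial (Der J) \<rho> z)"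
      by (subst sum.reindex) (auto intro: inj_onI)
    also have "\<dots> = (\<Sum>J\<in>T. (partial (Der J) \<rho> z / a) * total_derivs (J - {#VT, VT#}) E z)"
    proof (intro sum.cong refl)
      fix J assume J: "J \<in> T"
      define K where "K = J - {#VT, VT#}"
      have JK: "add_mset VT J = K + ttt" unfolding K_def
        using T(2)[OF J] by (intro multiset_eqI) auto
      have K0: "count K VT = 0" using T(2)[OF J] by (simp add: K_def)
      have "retract z (Der (add_mset VT J)) = total_derivs K H (retract z)"
        using retract_high[of "K + ttt" z] JK by simp
      also have "\<dots> = total_derivs K H z"
        using total_derivs_H_weight[of K] K0 by (intro retract_low_order) simp
      finally have "total_derivs K E z = a * (z (Der (add_mset VT J)) - retract z (Der (add_mset VT J)))"
        by (simp add: total_derivs_E JK)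
      then show "(z (Der (add_mset VT J)) - retract z (Der (add_mset VT J))) * partial (Der J) \<rho> z
          = (partial (Der J) \<rho> z / a) * total_derivs (J - {#VT, VT#}) E z"
        using a_nz by (simp add: K_def)
    qed
    finally show ?thesis .
  qed
  have "reducible (\<lambda>z. \<Sum>J\<in>T. (partial (Der J) \<rho> z * (1 / a)) * total_derivs (J - {#VT, VT#}) E z)"
  proof (intro reducible_sum T(1) reducible_by_parts diff_fun_mult diff_fun_const depends_only_mult
      depends_only_const)
    fix J assume "J \<in> T"
    from T(2)[OF this] show "VT \<notin># J - {#VT, VT#}" by (simp add: not_in_iff)
    show "diff_fun (partial (Der J) \<rho>)" "low_order (partial (Der J) \<rho>)"
      using diff_fun_partial[OF dP'] depends_only_partial[OF pP'] by (simp_all add: \<rho>_def)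
  qed
  then obtain \<Lambda> N where N: "diff_fun \<Lambda>" "low_order \<Lambda>" "\<And>i. diff_fun (N i)" "\<And>i. vanishes_mod E (N i)"
    "\<And>z. (\<Sum>J\<in>T. (partial (Der J) \<rho> z * (1 / a)) * total_derivs (J - {#VT, VT#}) E z) = \<Lambda> z * E z + total_div N z"
    by (rule reducibleE) blast
  show ?thesis
  proof (rule that[OF N(1,2)])
    show "diff_fun (\<lambda>z. P' i z - N i z)" for i by (intro diff_fun_diff dP' N)
    show "vanishes_mod E (\<lambda>z. P i z - (P' i z - N i z))" for i
      using N(4)[of i] by (simp add: vanishes_mod_def P'_def retract_id)
    show "total_div (\<lambda>i z. P' i z - N i z) z = \<Lambda> z * E z" for z
      using N(5)[of z] by (simp add: total_div_diff dP' N(3) div)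
  qed
qed

end

section \<open>The Euler operator\<close>

text \<open>
  The formal adjoint of the linearisation of \<open>A\<close>, applied to \<open>\<Lambda>\<close>. For \<open>\<Lambda> = 1\<close> it is the
  Euler operator applied to \<open>A\<close>.
\<close>

definition euler_pair :: "('n jet \<Rightarrow> real) \<Rightarrow> ('n jet \<Rightarrow> real) \<Rightarrow> 'n jet \<Rightarrow> real" where
  "euler_pair \<Lambda> A z = (\<Sum>J | partial (Der J) A \<noteq> (\<lambda>_. 0).
     (-1) ^ size J * total_derivs J (\<lambda>w. \<Lambda> w * partial (Der J) A w) z)"

lemma euler_pair_eq_sum:
  assumes "finite T" "\<And>J. J \<notin> T \<Longrightarrow> partial (Der J) A = (\<lambda>_. 0)"
  shows "euler_pair \<Lambda> A z = (\<Sum>J\<in>T. (-1) ^ size J * total_derivs J (\<lambda>w. \<Lambda> w * partial (Der J) A w) z)"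
  unfolding euler_pair_def using assms by (intro sum.mono_neutral_left) auto

lemma diff_fun_Der_support:
  assumes "diff_fun A"
  obtains T where "finite T" "\<And>J. J \<notin> T \<Longrightarrow> partial (Der J) A = (\<lambda>_. 0)"
proof -
  obtain S where S: "finite S" "depends_only S A" using assms by (rule diff_funE)
  show ?thesis
  proof
    have "{J. Der J \<in> S} \<subseteq> (\<lambda>c. case c of Der J \<Rightarrow> J) ` S" by force
    then show "finite {J. Der J \<in> S}" using S(1) finite_subset by auto
    show "partial (Der J) A = (\<lambda>_. 0)" if "J \<notin> {J. Der J \<in> S}" for J
      using partial_outside[OF S(2)] that by simp
  qed
qed

lemma euler_pair_add_right:
  assumes "diff_fun \<Lambda>" "diff_fun A" "diff_fun B"
  shows "euler_pair \<Lambda> (\<lambda>z. A z + B z) z = euler_pair \<Lambda> A z + euler_pair \<Lambda> B z"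
proof -
  obtain T where T: "finite T" "\<And>J. J \<notin> T \<Longrightarrow> partial (Der J) A = (\<lambda>_. 0)"
    using assms(2) by (rule diff_fun_Der_support) blast
  obtain U where U: "finite U" "\<And>J. J \<notin> U \<Longrightarrow> partial (Der J) B = (\<lambda>_. 0)"
    using assms(3) by (rule diff_fun_Der_support) blast
  have p: "partial (Der J) (\<lambda>z. A z + B z) = (\<lambda>z. partial (Der J) A z + partial (Der J) B z)" for J
    by (rule ext) (rule partial_add[OF assms(2,3)])
  have *: "total_derivs J (\<lambda>w. \<Lambda> w * (partial (Der J) A w + partial (Der J) B w)) z =
      total_derivs J (\<lambda>w. \<Lambda> w * partial (Der J) A w) z + total_derivs J (\<lambda>w. \<Lambda> w * partial (Der J) B w) z" for J
    unfolding distrib_left by (intro total_derivs_add diff_fun_mult diff_fun_partial assms)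
  have A: "euler_pair \<Lambda> A z = (\<Sum>J\<in>T \<union> U. (-1) ^ size J * total_derivs J (\<lambda>w. \<Lambda> w * partial (Der J) A w) z)"
    using T U by (intro euler_pair_eq_sum) auto
  have B: "euler_pair \<Lambda> B z = (\<Sum>J\<in>T \<union> U. (-1) ^ size J * total_derivs J (\<lambda>w. \<Lambda> w * partial (Der J) B w) z)"
    using T U by (intro euler_pair_eq_sum) auto
  have "euler_pair \<Lambda> (\<lambda>z. A z + B z) z =
      (\<Sum>J\<in>T \<union> U. (-1) ^ size J * total_derivs J (\<lambda>w. \<Lambda> w * partial (Der J) (\<lambda>z. A z + B z) w) z)"
    using T U by (intro euler_pair_eq_sum) (auto simp: p)
  then show ?thesis unfolding A B by (simp only: p *) (simp only: distrib_left sum.distrib)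
qed

lemma euler_pair_const_right: "euler_pair \<Lambda> (\<lambda>_. k) z = 0"
proof -
  have "partial (Der J) (\<lambda>_. k) = (\<lambda>_. 0)" for J by (rule ext) simp
  then show ?thesis by (simp add: euler_pair_def)
qed

lemma euler_pair_cmult_right:
  assumes "diff_fun \<Lambda>" "diff_fun A"
  shows "euler_pair \<Lambda> (\<lambda>z. k * A z) z = k * euler_pair \<Lambda> A z"
proof -
  obtain T where T: "finite T" "\<And>J. J \<notin> T \<Longrightarrow> partial (Der J) A = (\<lambda>_. 0)"
    using assms(2) by (rule diff_fun_Der_support) blast
  have p: "partial (Der J) (\<lambda>z. k * A z) = (\<lambda>z. k * partial (Der J) A z)" for J
    by (rule ext) (simp add: partial_mult diff_fun_const assms(2))
  have *: "total_derivs J (\<lambda>w. \<Lambda> w * (k * partial (Der J) A w)) z = k * total_derivs J (\<lambda>w. \<Lambda> w * partial (Der J) A w) z" for J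
    unfolding mult.left_commute[of _ k] by (intro total_derivs_cmult diff_fun_mult diff_fun_partial assms)
  have A: "euler_pair \<Lambda> A z = (\<Sum>J\<in>T. (-1) ^ size J * total_derivs J (\<lambda>w. \<Lambda> w * partial (Der J) A w) z)"
    using T by (intro euler_pair_eq_sum) auto
  have "euler_pair \<Lambda> (\<lambda>z. k * A z) z =
      (\<Sum>J\<in>T. (-1) ^ size J * total_derivs J (\<lambda>w. \<Lambda> w * partial (Der J) (\<lambda>z. k * A z) w) z)"
    using T by (intro euler_pair_eq_sum) (auto simp: p)
  then show ?thesis unfolding A by (simp only: p *) (simp only: sum_distrib_left mult.left_commute[of _ k])
qed

lemma euler_pair_sum_right:
  assumes "diff_fun \<Lambda>" "\<And>j. j \<in> S \<Longrightarrow> diff_fun (A j)"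
  shows "euler_pair \<Lambda> (\<lambda>z. \<Sum>j\<in>S. A j z) z = (\<Sum>j\<in>S. euler_pair \<Lambda> (A j) z)"
  using assms(2)
  by (induction S rule: infinite_finite_induct)
    (simp_all add: euler_pair_const_right euler_pair_add_right assms(1) diff_fun_sum)

lemma euler_pair_zero_left: "euler_pair (\<lambda>_. 0) A z = 0"
  by (simp add: euler_pair_def)

lemma euler_pair_Leibniz:
  assumes "diff_fun A" "diff_fun B"
  shows "euler_pair (\<lambda>_. 1) (\<lambda>z. A z * B z) z = euler_pair A B z + euler_pair B A z"
proof -
  obtain T where T: "finite T" "\<And>J. J \<notin> T \<Longrightarrow> partial (Der J) A = (\<lambda>_. 0)"
    using assms(1) by (rule diff_fun_Der_support) blast
  obtain U where U: "finite U" "\<And>J. J \<notin> U \<Longrightarrow> partial (Der J) B = (\<lambda>_. 0)"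
    using assms(2) by (rule diff_fun_Der_support) blast
  have p: "partial (Der J) (\<lambda>z. A z * B z) = (\<lambda>z. A z * partial (Der J) B z + B z * partial (Der J) A z)" for J
    by (rule ext) (simp add: partial_mult assms)
  have *: "total_derivs J (\<lambda>w. A w * partial (Der J) B w + B w * partial (Der J) A w) z =
      total_derivs J (\<lambda>w. A w * partial (Der J) B w) z + total_derivs J (\<lambda>w. B w * partial (Der J) A w) z" for J
    by (intro total_derivs_add diff_fun_mult diff_fun_partial assms)
  have A: "euler_pair A B z = (\<Sum>J\<in>T \<union> U. (-1) ^ size J * total_derivs J (\<lambda>w. A w * partial (Der J) B w) z)"
    using T U by (intro euler_pair_eq_sum) auto
  have B: "euler_pair B A z = (\<Sum>J\<in>T \<union> U. (-1) ^ size J * total_derivs J (\<lambda>w. B w * partial (Der J) A w) z)"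
    using T U by (intro euler_pair_eq_sum) auto
  have "euler_pair (\<lambda>_. 1) (\<lambda>z. A z * B z) z =
      (\<Sum>J\<in>T \<union> U. (-1) ^ size J * total_derivs J (\<lambda>w. 1 * partial (Der J) (\<lambda>z. A z * B z) w) z)"
    using T U by (intro euler_pair_eq_sum) (auto simp: p)
  then show ?thesis unfolding A B by (simp add: p * distrib_left sum.distrib)
qed

text \<open>
  Linearisation commutes with total derivatives and \<open>- D\<^sub>i\<close> is the adjoint of \<open>D\<^sub>i\<close>. In
  coordinates, the commutator terms in the derivatives of \<open>D\<^sub>i A\<close> telescope against the terms in
  which \<open>D\<^sub>i\<close> falls on the derivatives of \<open>A\<close>. Everything that is needed about the Euler
  operator follows from this rule and the Leibniz rule.
\<close>

lemma euler_pair_total_deriv: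
  assumes "diff_fun \<Lambda>" "diff_fun A"
  shows "euler_pair \<Lambda> (total_deriv i A) z = - euler_pair (total_deriv i \<Lambda>) A z"
proof -
  obtain T where T: "finite T" "\<And>J. J \<notin> T \<Longrightarrow> partial (Der J) A = (\<lambda>_. 0)"
    using assms(2) by (rule diff_fun_Der_support) blast
  define U where "U = T \<union> add_mset i ` T"
  have U: "finite U" using T by (simp add: U_def)
  define t where "t = (\<lambda>J B. (-1 :: real) ^ size J * total_derivs J B z)"
  \<comment> \<open>the commutator part of the \<open>J\<close>-derivative of \<open>total_deriv i A\<close>, times \<open>\<Lambda>\<close>\<close>
  define lower where "lower = (\<lambda>J w. if i \<in># J then \<Lambda> w * partial (Der (J - {#i#})) A w else 0)"
  have dP: "diff_fun (partial (Der J) A)" for J by (rule diff_fun_partial[OF assms(2)])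
  have dL: "diff_fun (lower J)" for J
    unfolding lower_def by (cases "i \<in># J") (simp_all add: diff_fun_mult assms dP diff_fun_const)
  have dTP: "diff_fun (\<lambda>w. \<Lambda> w * total_deriv i (partial (Der J) A) w)" for J
    by (intro diff_fun_mult assms diff_fun_total_deriv dP)
  have outside: "lower J = (\<lambda>_. 0)" if "J \<notin> add_mset i ` T" for J
  proof (cases "i \<in># J")
    case True
    then have "J - {#i#} \<notin> T" using that by (metis image_eqI insert_DiffM)
    from T(2)[OF this] show ?thesis by (simp add: lower_def fun_eq_iff)
  qed (simp add: lower_def)
  have part: "(\<lambda>w. \<Lambda> w * partial (Der J) (total_deriv i A) w) =
      (\<lambda>w. \<Lambda> w * total_deriv i (partial (Der J) A) w + lower J w)" for J
    by (rule ext) (simp add: partial_Der_total_deriv[OF assms(2)] lower_def distrib_left)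
  have supp: "partial (Der J) (total_deriv i A) = (\<lambda>_. 0)" if "J \<notin> U" for J
  proof
    fix w
    have "J \<notin> T" "\<not> (i \<in># J \<and> J - {#i#} \<in> T)"
      using that by (auto simp: U_def) (metis image_eqI insert_DiffM)
    then show "partial (Der J) (total_deriv i A) w = 0"
      using T(2)[of "J - {#i#}"] by (auto simp: partial_Der_total_deriv[OF assms(2)] T(2))
  qed
  have "euler_pair \<Lambda> (total_deriv i A) z
      = (\<Sum>J\<in>U. t J (\<lambda>w. \<Lambda> w * partial (Der J) (total_deriv i A) w))"
    unfolding t_def by (rule euler_pair_eq_sum[OF U supp])
  also have "\<dots> = (\<Sum>J\<in>U. t J (\<lambda>w. \<Lambda> w * total_deriv i (partial (Der J) A) w)) + (\<Sum>J\<in>U. t J (lower J))"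
    unfolding part t_def by (simp add: total_derivs_add dTP dL distrib_left sum.distrib)
  also have "(\<Sum>J\<in>U. t J (\<lambda>w. \<Lambda> w * total_deriv i (partial (Der J) A) w))
      = (\<Sum>J\<in>T. t J (\<lambda>w. \<Lambda> w * total_deriv i (partial (Der J) A) w))"
    using U T by (intro sum.mono_neutral_right) (auto simp: U_def t_def T(2))
  also have "(\<Sum>J\<in>U. t J (lower J)) = (\<Sum>J\<in>add_mset i ` T. t J (lower J))"
    using U by (intro sum.mono_neutral_right) (auto simp: U_def t_def outside)
  also have "\<dots> = (\<Sum>J\<in>T. t (add_mset i J) (\<lambda>w. \<Lambda> w * partial (Der J) A w))"
    by (subst sum.reindex) (auto intro: inj_onI simp: lower_def)
  also have "\<dots> = (\<Sum>J\<in>T. - (t J (\<lambda>w. total_deriv i \<Lambda> w * partial (Der J) A w)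
        + t J (\<lambda>w. \<Lambda> w * total_deriv i (partial (Der J) A) w)))"
  proof (intro sum.cong refl)
    fix J
    have d: "diff_fun (\<lambda>w. \<Lambda> w * partial (Der J) A w)" by (intro diff_fun_mult assms dP)
    have "total_deriv i (\<lambda>w. \<Lambda> w * partial (Der J) A w) =
        (\<lambda>w. total_deriv i \<Lambda> w * partial (Der J) A w + \<Lambda> w * total_deriv i (partial (Der J) A) w)"
      by (rule ext) (rule total_deriv_mult[OF assms(1) dP])
    then have "total_derivs (add_mset i J) (\<lambda>w. \<Lambda> w * partial (Der J) A w) z =
        total_derivs J (\<lambda>w. total_deriv i \<Lambda> w * partial (Der J) A w) z +
        total_derivs J (\<lambda>w. \<Lambda> w * total_deriv i (partial (Der J) A) w) z"
      by (simp add: total_derivs_add_mset[OF d] total_derivs_of_total_deriv[OF d, symmetric] total_derivs_add dTP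
          diff_fun_mult diff_fun_total_deriv assms(1) dP)
    then show "t (add_mset i J) (\<lambda>w. \<Lambda> w * partial (Der J) A w) =
        - (t J (\<lambda>w. total_deriv i \<Lambda> w * partial (Der J) A w)
        + t J (\<lambda>w. \<Lambda> w * total_deriv i (partial (Der J) A) w))"
      by (simp add: t_def algebra_simps)
  qed
  also have "(\<Sum>J\<in>T. t J (\<lambda>w. \<Lambda> w * total_deriv i (partial (Der J) A) w)) + \<dots>
      = - (\<Sum>J\<in>T. t J (\<lambda>w. total_deriv i \<Lambda> w * partial (Der J) A w))"
    by (simp add: sum_negf sum.distrib sum_subtractf)
  also have "(\<Sum>J\<in>T. t J (\<lambda>w. total_deriv i \<Lambda> w * partial (Der J) A w)) = euler_pair (total_deriv i \<Lambda>) A z"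
    unfolding t_def by (rule euler_pair_eq_sum[OF T, symmetric])
  finally show ?thesis .
qed

lemma euler_total_div:
  fixes Q :: "'n::finite current"
  assumes "\<And>i. diff_fun (Q i)"
  shows "euler_pair (\<lambda>_. 1) (total_div Q) z = 0"
proof -
  have "total_div Q = (\<lambda>z. \<Sum>i\<in>UNIV. total_deriv i (Q i) z)"
    by (rule ext) (rule total_div_eq_sum)
  then have "euler_pair (\<lambda>_. 1) (total_div Q) z = (\<Sum>i\<in>UNIV. euler_pair (\<lambda>_. 1) (total_deriv i (Q i)) z)"
    by (simp add: euler_pair_sum_right diff_fun_const diff_fun_total_deriv assms)
  moreover have "euler_pair (\<lambda>_. 1) (total_deriv i (Q i)) z = 0" for i
  proof -
    have "total_deriv i (\<lambda>_. 1 :: real) = (\<lambda>_. 0)" by (rule ext) simp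
    then show ?thesis
      using euler_pair_total_deriv[OF diff_fun_const assms] by (simp add: euler_pair_zero_left)
  qed
  ultimately show ?thesis by simp
qed

lemma euler_pair_function_of_u:
  assumes "smooth_real h"
  shows "euler_pair \<Lambda> (\<lambda>z. h (u_coord z)) z = \<Lambda> z * deriv h (u_coord z)"
proof -
  have p: "partial (Der J) (\<lambda>z. h (u_coord z)) = (if J = {#} then (\<lambda>z. deriv h (u_coord z)) else (\<lambda>_. 0))" for J
    by (auto simp: u_coord_def partial_def)
  have "euler_pair \<Lambda> (\<lambda>z. h (u_coord z)) z = (\<Sum>J\<in>{{#}}. (-1) ^ size J * total_derivs J (\<lambda>w. \<Lambda> w * partial (Der J) (\<lambda>z. h (u_coord z)) w) z)"
    by (rule euler_pair_eq_sum) (auto simp: p)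
  then show ?thesis by (simp add: p)
qed

lemma euler_pair_u: "euler_pair \<Lambda> u_coord z = \<Lambda> z"
proof -
  have "smooth_real (\<lambda>x. x)"
  proof -
    have "(deriv ^^ k) (\<lambda>x::real. x) differentiable at x" for k x
    proof (cases k)
      case (Suc m)
      have "deriv (\<lambda>x::real. x) = (\<lambda>_. 1)" by (rule ext) simp
      moreover have "\<exists>c. (deriv ^^ m) (\<lambda>_::real. 1::real) = (\<lambda>_. c)"
        by (induction m) auto
      ultimately show ?thesis using Suc by (auto simp: funpow_swap1)
    qed simp
    then show ?thesis by (simp add: smooth_real_def)
  qed
  from euler_pair_function_of_u[OF this, of \<Lambda> z] show ?thesis
    by (simp add: eta_contract_eq)
qed

context normal_form begin

text \<open>
  The Euler operator annihilates \<open>\<Lambda> E\<close>, which is a divergence. Of the two terms of the Leibniz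
  rule, the one in which \<open>E\<close> is the coefficient vanishes on solutions.
\<close>

lemma multiplier_equation_on_shell:
  assumes "diff_fun \<Lambda>" "\<And>i. diff_fun (Q i)" "\<And>z. total_div Q z = \<Lambda> z * E z"
  shows "vanishes_mod E (euler_pair \<Lambda> E)"
  unfolding vanishes_mod_def
proof
  fix z assume z: "z \<in> prolongation E"
  have "total_div Q = (\<lambda>z. \<Lambda> z * E z)" using assms(3) by (rule ext)
  then have "euler_pair \<Lambda> E z + euler_pair E \<Lambda> z = 0"
    using euler_total_div[where Q = Q and z = z, OF assms(2)] by (simp add: euler_pair_Leibniz assms(1) diff_fun_E)
  moreover have "euler_pair E \<Lambda> z = 0"
    unfolding euler_pair_def
  proof (intro sum.neutral ballI)
    fix J
    have "vanishes_mod E (\<lambda>w. E w * partial (Der J) \<Lambda> w)"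
      using vanishes_E by (simp add: vanishes_mod_def)
    then have "vanishes_mod E (total_derivs J (\<lambda>w. E w * partial (Der J) \<Lambda> w))"
      by (intro vanishes_total_derivs diff_fun_mult diff_fun_E diff_fun_partial assms(1))
    then show "(- 1) ^ size J * total_derivs J (\<lambda>w. E w * partial (Der J) \<Lambda> w) z = 0"
      using z by (simp add: vanishes_mod_def)
  qed
  ultimately show "euler_pair \<Lambda> E z = 0" by simp
qed

end

section \<open>Leading terms with respect to a weight\<close>

text \<open>
  \<open>F\<close> is linear in the coordinates \<open>u\<^bsub>J+L\<^esub>\<close>, \<open>J \<in> T\<close>, with coefficients \<open>k J\<close>, up to terms
  of weight lower than that of these coordinates, where \<open>m\<close> is the weight of the
  elements of \<open>T\<close>.
\<close>

definition leading_form ::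
  "('n ivar \<Rightarrow> nat) \<Rightarrow> nat \<Rightarrow> 'n ivar multiset set \<Rightarrow> ('n ivar multiset \<Rightarrow> 'n jet \<Rightarrow> real) \<Rightarrow>
    'n ivar multiset \<Rightarrow> ('n jet \<Rightarrow> real) \<Rightarrow> bool" where
  "leading_form \<omega> m T k L F \<longleftrightarrow> (\<exists>A. diff_fun A \<and> depends_only {c. weight \<omega> c < m + (\<Sum>i\<in>#L. \<omega> i)} A \<and>
     (\<forall>z. F z = A z + (\<Sum>J\<in>T. k J z * z (Der (J + L)))))"

lemma weight_lt_iff_le: "0 < m \<Longrightarrow> {c. weight \<omega> c < m} = {c. weight \<omega> c \<le> m - 1}"
  by auto

text \<open>
  The first derivative of a function of weight \<open>m\<close> is already linear in the coordinates of weight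
  \<open>m + \<omega> i\<close>, although the function itself may be nonlinear in those of weight \<open>m\<close>.
\<close>

lemma leading_form_first:
  assumes L: "diff_fun \<Lambda>" and S: "finite S" "S \<subseteq> {c. weight \<omega> c \<le> m}" "depends_only S \<Lambda>"
    and i: "0 < \<omega> i"
  defines "T \<equiv> {J. Der J \<in> S \<and> weight \<omega> (Der J) = m}"
  shows "leading_form \<omega> m T (\<lambda>J. partial (Der J) \<Lambda>) {#i#} (total_deriv i \<Lambda>)"
proof -
  define A where "A = (\<lambda>z. \<Sum>c\<in>S - Der ` T. vfield i c z * partial c \<Lambda> z)"
  have sub: "Der ` T \<subseteq> S" by (auto simp: T_def)
  have "diff_fun A" unfolding A_def
    by (intro diff_fun_sum diff_fun_mult diff_fun_vfield diff_fun_partial L)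
  moreover have "depends_only {c. weight \<omega> c < m + (\<Sum>i\<in>#{#i#}. \<omega> i)} A"
    unfolding A_def
  proof (intro depends_only_sum depends_only_mult)
    fix c assume c: "c \<in> S - Der ` T"
    show "depends_only {c. weight \<omega> c < m + (\<Sum>i\<in>#{#i#}. \<omega> i)} (partial c \<Lambda>)"
      by (rule depends_only_mono[OF depends_only_partial[OF S(3)]]) (use S(2) i in auto)
    show "depends_only {c. weight \<omega> c < m + (\<Sum>i\<in>#{#i#}. \<omega> i)} (vfield i c)"
    proof (cases c)
      case (Der J)
      then have "weight \<omega> c < m" using c S(2) by (force simp: T_def)
      then show ?thesis using i
        by (intro depends_only_mono[OF weight_le_vfield[of \<omega> c i]]) auto
    qed (simp add: depends_only_def)
  qed
  moreover have "total_deriv i \<Lambda> z = A z + (\<Sum>J\<in>T. partial (Der J) \<Lambda> z * z (Der (J + {#i#})))" for z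
  proof -
    have "total_deriv i \<Lambda> z = (\<Sum>c\<in>S. vfield i c z * partial c \<Lambda> z)"
      by (rule total_deriv_eq_sum[OF S(1,3)])
    also have "\<dots> = A z + (\<Sum>c\<in>Der ` T. vfield i c z * partial c \<Lambda> z)"
      unfolding A_def by (rule sum.subset_diff[OF sub S(1)])
    also have "(\<Sum>c\<in>Der ` T. vfield i c z * partial c \<Lambda> z) = (\<Sum>J\<in>T. partial (Der J) \<Lambda> z * z (Der (J + {#i#})))"
      by (subst sum.reindex) (auto intro: inj_onI simp: mult.commute)
    finally show ?thesis .
  qed
  ultimately show ?thesis unfolding leading_form_def by blast
qed

lemma depends_only_lt_total_deriv:
  assumes "diff_fun A" "0 < m" "depends_only {c. weight \<omega> c < m} A"
  shows "depends_only {c. weight \<omega> c < m + \<omega> i} (total_deriv i A)"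
  by (rule depends_only_mono[OF weight_le_total_deriv[OF assms(1), of \<omega> "m - 1"]])
    (use assms in \<open>auto simp: weight_lt_iff_le\<close>)

text \<open>
  A further derivative falls on \<open>u\<^bsub>J+L\<^esub>\<close> in the leading terms; when it falls on a coefficient,
  the result has lower weight because \<open>L\<close> has positive weight.
\<close>

lemma leading_form_step:
  assumes "leading_form \<omega> m T k L F" and "finite T"
    and k: "\<And>J. J \<in> T \<Longrightarrow> diff_fun (k J)" "\<And>J. J \<in> T \<Longrightarrow> weight_le \<omega> m (k J)"
    and T: "\<And>J. J \<in> T \<Longrightarrow> weight \<omega> (Der J) = m"
    and pos: "0 < \<omega> i" "0 < (\<Sum>i\<in>#L. \<omega> i)"
  shows "leading_form \<omega> m T k (add_mset i L) (total_deriv i F)"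
proof -
  obtain A where A: "diff_fun A" "depends_only {c. weight \<omega> c < m + (\<Sum>i\<in>#L. \<omega> i)} A"
     "\<And>z. F z = A z + (\<Sum>J\<in>T. k J z * z (Der (J + L)))"
    using assms(1) unfolding leading_form_def by blast
  let ?S = "{c. weight \<omega> c < m + (\<Sum>i\<in>#add_mset i L. \<omega> i)}"
  define B where "B = (\<lambda>z. total_deriv i A z + (\<Sum>J\<in>T. total_deriv i (k J) z * z (Der (J + L))))"
  have "diff_fun B" unfolding B_def
    by (intro diff_fun_add diff_fun_sum diff_fun_mult diff_fun_total_deriv diff_fun_coord A k)
  moreover have "depends_only ?S B"
    unfolding B_def
  proof (intro depends_only_add depends_only_sum depends_only_mult depends_only_coord)
    show "depends_only ?S (total_deriv i A)"
      by (rule depends_only_mono[OF depends_only_lt_total_deriv[OF A(1) _ A(2)]]) (use pos in auto)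
    fix J assume J: "J \<in> T"
    show "depends_only ?S (total_deriv i (k J))"
      by (rule depends_only_mono[OF weight_le_total_deriv[OF k[OF J]]]) (use pos in auto)
    show "Der (J + L) \<in> ?S" using T[OF J] pos by simp
  qed
  moreover have "total_deriv i F z = B z + (\<Sum>J\<in>T. k J z * z (Der (J + add_mset i L)))" for z
  proof -
    have "F = (\<lambda>z. A z + (\<Sum>J\<in>T. k J z * z (Der (J + L))))" using A(3) by (rule ext)
    then have "total_deriv i F z = total_deriv i A z + (\<Sum>J\<in>T. total_deriv i (\<lambda>z. k J z * z (Der (J + L))) z)"
      by (simp add: total_deriv_add total_deriv_sum A(1) diff_fun_sum diff_fun_mult k diff_fun_coord)
    also have "(\<Sum>J\<in>T. total_deriv i (\<lambda>z. k J z * z (Der (J + L))) z)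
       = (\<Sum>J\<in>T. total_deriv i (k J) z * z (Der (J + L)) + k J z * z (Der (J + add_mset i L)))"
      by (intro sum.cong refl) (simp add: total_deriv_mult k diff_fun_coord)
    finally show ?thesis by (simp add: B_def sum.distrib)
  qed
  ultimately show ?thesis unfolding leading_form_def by blast
qed

context normal_form begin

text \<open>
  If \<open>u\<^bsub>ttt\<^esub>\<close> is at least as heavy as the right-hand side, then solving for the principal
  coordinates does not raise weights.
\<close>

lemma retract_weight:
  assumes H: "weight_le \<omega> (3 * \<omega> VT) H"
  shows "weight_le \<omega> (weight \<omega> c) (\<lambda>z. retract z c)"
proof (induction "weight t_weight c" arbitrary: c rule: less_induct)
  case less
  show ?case
  proof (cases c rule: coord_cases)
    case low
    then have "(\<lambda>z. retract z c) = (\<lambda>z. z c)" by (simp add: retract_low)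
    then show ?thesis by (simp add: depends_only_coord)
  next
    case (high J)
    define g where "g = (\<lambda>d z. if weight t_weight d < count J VT then retract z d else 0)"
    have eq: "(\<lambda>z. retract z c) = (\<lambda>z. total_derivs (J - ttt) H (\<lambda>d. g d z))"
      using high retract_high_cut by (auto simp: g_def)
    have "weight \<omega> (Der (J - ttt + ttt)) = 3 * \<omega> VT + (\<Sum>i\<in>#J - ttt. \<omega> i)" by simp
    then have w: "weight \<omega> c = 3 * \<omega> VT + (\<Sum>i\<in>#J - ttt. \<omega> i)"
      unfolding split_ttt[OF high(2)] high(1) .
    have dep: "weight_le \<omega> (weight \<omega> c) (total_derivs (J - ttt) H)"
      unfolding w by (rule weight_le_total_derivs[OF diff_fun_H H])
    have g: "weight_le \<omega> (weight \<omega> c) (g d)" if "d \<in> {d. weight \<omega> d \<le> weight \<omega> c}" for d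
    proof (cases "weight t_weight d < count J VT")
      case True
      then have "weight_le \<omega> (weight \<omega> d) (\<lambda>z. retract z d)"
        using less[of d] high weight_t_weight[of J] by simp
      then show ?thesis using that True by (auto simp: g_def intro: weight_le_mono)
    qed (simp add: g_def depends_only_const)
    show ?thesis unfolding eq by (rule depends_only_compose[where g = g, OF dep g])
  qed
qed

lemma weight_le_retract:
  assumes "weight_le \<omega> (3 * \<omega> VT) H" "weight_le \<omega> m F"
  shows "weight_le \<omega> m (\<lambda>z. F (retract z))"
proof -
  have "weight_le \<omega> m (\<lambda>z. F (\<lambda>c. retract z c))"
    by (rule depends_only_compose[where g = "\<lambda>c z. retract z c", OF assms(2)])
      (auto intro: weight_le_mono[OF retract_weight[OF assms(1)]])
  then show ?thesis by simp
qed

end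

section \<open>The equation and its adjoint\<close>

text \<open>
  The adjoint linearisation of the equation; the derivatives of \<open>f'(u)\<close> cancel in it.
\<close>

definition adjoint_eqn :: "(real \<Rightarrow> real) \<Rightarrow> real \<Rightarrow> real \<Rightarrow> ('n::finite jet \<Rightarrow> real) \<Rightarrow> 'n jet \<Rightarrow> real" where
  "adjoint_eqn f a b \<Lambda> z = total_deriv VX (total_deriv VT \<Lambda>) z
     + deriv f (u_coord z) * total_deriv VT (total_deriv VT \<Lambda>) z
     - a * total_deriv VT (total_deriv VT (total_deriv VT \<Lambda>)) z + b * laplace_y \<Lambda> z"

lemma diff_fun_u: "diff_fun u_coord"
  using diff_fun_coord[of "Der {#}"] by (simp add: u_coord_def[abs_def])

lemma diff_fun_f_u: "smooth_real f \<Longrightarrow> diff_fun (\<lambda>w. f (u_coord w))"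
  using diff_fun_real_coord[of f "Der {#}"] by (simp add: u_coord_def)

lemma diff_fun_laplace: "diff_fun F \<Longrightarrow> diff_fun (laplace_y F)"
  unfolding laplace_y_def[abs_def] by (intro diff_fun_sum diff_fun_total_deriv)

lemma total_deriv_Der: "total_deriv i (\<lambda>z. z (Der J)) = (\<lambda>z. z (Der (add_mset i J)))"
  by (rule ext) simp

lemma total_deriv_u: "total_deriv i u_coord = (\<lambda>z. z (Der {#i#}))"
  unfolding u_coord_def[abs_def] by (rule total_deriv_Der)

lemma laplace_u: "laplace_y u_coord z = (\<Sum>j\<in>UNIV. z (Der {#VY j, VY j#}))"
  by (simp add: laplace_y_def total_deriv_u)

lemma euler_pair_twice:
  assumes "diff_fun \<Lambda>" "diff_fun A"
  shows "euler_pair \<Lambda> (total_deriv i (total_deriv j A)) z = euler_pair (total_deriv j (total_deriv i \<Lambda>)) A z"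
  using assms by (simp add: euler_pair_total_deriv diff_fun_total_deriv)

lemma euler_pair_eqn:
  fixes \<Lambda> :: "'n::finite jet \<Rightarrow> real"
  assumes f: "smooth_real f" and L: "diff_fun \<Lambda>"
  shows "euler_pair \<Lambda> (eqn f a b) z = adjoint_eqn f a b \<Lambda> z"
proof -
  let ?u = "u_coord :: 'n jet \<Rightarrow> real"
  have u: "diff_fun ?u" "diff_fun (\<lambda>w :: 'n jet. f (u_coord w))"
    by (rule diff_fun_u, rule diff_fun_f_u[OF f])
  have lap: "laplace_y ?u = (\<lambda>z. \<Sum>j\<in>UNIV. total_deriv (VY j) (total_deriv (VY j) ?u) z)"
    by (rule ext) (rule laplace_y_def)
  have E: "eqn f a b = (\<lambda>z :: 'n jet. total_deriv VX (total_deriv VT ?u) z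
     + total_deriv VT (total_deriv VT (\<lambda>w. f (u_coord w))) z
     + a * total_deriv VT (total_deriv VT (total_deriv VT ?u)) z
     + b * laplace_y ?u z)"
    by (rule ext) (simp add: eqn_def)
  have 1: "euler_pair \<Lambda> (total_deriv VX (total_deriv VT ?u)) z = total_deriv VX (total_deriv VT \<Lambda>) z"
    using euler_pair_twice[OF L u(1)] total_deriv_commute[OF L] by (simp add: euler_pair_u)
  have 2: "euler_pair \<Lambda> (total_deriv VT (total_deriv VT (\<lambda>w. f (u_coord w)))) z
     = deriv f (u_coord z) * total_deriv VT (total_deriv VT \<Lambda>) z"
    using euler_pair_twice[OF L u(2)] by (simp add: euler_pair_function_of_u[OF f] mult.commute)
  have 3: "euler_pair \<Lambda> (total_deriv VT (total_deriv VT (total_deriv VT ?u))) z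
     = - total_deriv VT (total_deriv VT (total_deriv VT \<Lambda>)) z"
    using euler_pair_twice[OF L diff_fun_total_deriv[OF u(1)]]
    by (simp add: euler_pair_total_deriv[OF _ u(1)] diff_fun_total_deriv L euler_pair_u)
  have 4: "euler_pair \<Lambda> (laplace_y ?u) z = laplace_y \<Lambda> z"
    unfolding lap using euler_pair_twice[OF L u(1)]
    by (simp add: euler_pair_sum_right L diff_fun_total_deriv u euler_pair_u laplace_y_def)
  show ?thesis unfolding E adjoint_eqn_def
    by (simp add: euler_pair_add_right euler_pair_cmult_right L diff_fun_add diff_fun_mult diff_fun_const
        diff_fun_total_deriv u diff_fun_laplace 1 2 3 4)
qed

text \<open>
  The right-hand side after solving the equation for \<open>u\<^bsub>ttt\<^esub>\<close>.
\<close>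

definition solved_rhs :: "(real \<Rightarrow> real) \<Rightarrow> real \<Rightarrow> real \<Rightarrow> 'n::finite jet \<Rightarrow> real" where
  "solved_rhs f a b z = - (1 / a) * (z (Der {#VX, VT#})
     + total_deriv VT (total_deriv VT (\<lambda>w. f (u_coord w))) z + b * (\<Sum>j\<in>UNIV. z (Der {#VY j, VY j#})))"

lemma weight_le_f_u: "weight_le \<omega> 0 (\<lambda>w. f (u_coord w))"
  by (simp add: depends_only_def u_coord_def)

lemma weight_le_f_tt:
  assumes "smooth_real f" "2 * \<omega> VT \<le> m"
  shows "weight_le \<omega> m (total_deriv VT (total_deriv VT (\<lambda>w. f (u_coord w))))"
proof -
  have "weight_le \<omega> (0 + \<omega> VT + \<omega> VT) (total_deriv VT (total_deriv VT (\<lambda>w. f (u_coord w))))"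
    by (intro weight_le_total_deriv diff_fun_total_deriv diff_fun_f_u assms weight_le_f_u)
  then show ?thesis by (rule weight_le_mono) (use assms(2) in simp)
qed

lemma weight_le_coord: "weight \<omega> c \<le> m \<Longrightarrow> weight_le \<omega> m (\<lambda>z. z c)"
  by (simp add: depends_only_coord)

lemma normal_form_eqn:
  assumes "a \<noteq> 0" "smooth_real f"
  shows "normal_form (eqn f a b :: 'n::finite jet \<Rightarrow> real) (solved_rhs f a b) a"
proof
  show "eqn f a b z = a * (z (Der ttt) - solved_rhs f a b z)" for z :: "'n jet"
    using assms(1) unfolding eqn_def solved_rhs_def laplace_u by (simp add: total_deriv_u total_deriv_Der field_simps)
  show "diff_fun (solved_rhs f a b)"
    unfolding solved_rhs_def[abs_def]
    by (intro diff_fun_mult diff_fun_add diff_fun_const diff_fun_coord diff_fun_sum diff_fun_total_deriv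
        diff_fun_f_u assms)
  show "low_order (solved_rhs f a b)"
    unfolding solved_rhs_def[abs_def]
    by (intro depends_only_mult depends_only_add depends_only_const depends_only_sum
        weight_le_coord weight_le_f_tt assms) (simp_all add: t_weight_def)
qed fact

lemma total_deriv_of_point_function:
  assumes "depends_only (range Ind) F"
  shows "total_deriv i F = partial (Ind i) F"
proof -
  have "partial (Der J) F = (\<lambda>_. 0)" for J using partial_outside[OF assms] by blast
  then show ?thesis by (intro ext) (simp add: total_deriv_def)
qed

section \<open>Multipliers depend on the independent variables only\<close>

text \<open>
  With this grading \<open>u\<^bsub>ttt\<^esub>\<close> and the second \<open>y\<^sub>j\<close>-derivative of \<open>u\<close> both have weight 6, and
  all other terms of the equation have weight at most 4. The leading part of the equation is thus
  \<open>a D\<^sub>t\<^sup>3 + b D\<^sub>y\<^sup>2\<close> and that of its adjoint is \<open>- a D\<^sub>t\<^sup>3 + b D\<^sub>y\<^sup>2\<close>.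
\<close>

definition lead_weight :: "'n \<Rightarrow> 'n ivar \<Rightarrow> nat" where
  "lead_weight j i = (if i = VT then 2 else if i = VY j then 3 else 0)"

lemma lead_weight_simps [simp]:
  "lead_weight j VT = 2" "lead_weight j VX = 0" "lead_weight j (VY k) = (if k = j then 3 else 0)"
  by (simp_all add: lead_weight_def)

text \<open>
  Suppose the multiplier has weight \<open>m\<close>. Modulo lower weight, the adjoint equation for it is
  linear in the coordinates of weight \<open>m + 6\<close>, and on solutions \<open>- a u\<^bsub>J+ttt\<^esub>\<close> equals
  \<open>b u\<^bsub>J+yy\<^esub>\<close> there. The odd and the even part of the adjoint therefore add up: the coefficient
  of the free coordinate \<open>u\<^bsub>J+yy\<^esub>\<close> is \<open>2 b\<close> times the derivative of the multiplier by
  \<open>u\<^sub>J\<close>, and it has to vanish. The function \<open>f\<close> enters only terms of lower weight, so it does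
  not matter where its second derivative vanishes.
\<close>

lemma leading_coefficient_zero:
  fixes \<Lambda> :: "'n::finite jet \<Rightarrow> real" and j0 :: 'n
  assumes ab: "a \<noteq> 0" "b \<noteq> 0" and f: "smooth_real f"
    and L: "diff_fun \<Lambda>" "low_order \<Lambda>" "weight_le (lead_weight j0) m \<Lambda>"
    and adj: "vanishes_mod (eqn f a b) (adjoint_eqn f a b \<Lambda>)"
    and J0: "weight (lead_weight j0) (Der J0) = m"
  shows "partial (Der J0) \<Lambda> = (\<lambda>_. 0)"
proof -
  let ?H = "solved_rhs f a b :: 'n jet \<Rightarrow> real"
  interpret normal_form "eqn f a b" ?H a by (rule normal_form_eqn[OF ab(1) f])
  define \<omega> where "\<omega> = lead_weight j0"
  define yy where "yy = {#VY j0, VY j0#}"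
  have \<omega>: "\<omega> VT = 2" "\<omega> VX = 0" "\<omega> (VY j0) = 3" "\<And>j. j \<noteq> j0 \<Longrightarrow> \<omega> (VY j) = 0"
    by (simp_all add: \<omega>_def)
  have "depends_only ({c. weight t_weight c \<le> 2} \<inter> {c. weight \<omega> c \<le> m}) \<Lambda>"
    using depends_only_Int[OF L(2,3)] by (simp add: \<omega>_def)
  with L(1) obtain S where S: "finite S" "S \<subseteq> {c. weight t_weight c \<le> 2} \<inter> {c. weight \<omega> c \<le> m}"
      "depends_only S \<Lambda>" by (rule diff_funE')
  have Sm: "S \<subseteq> {c. weight \<omega> c \<le> m}" using S(2) by blast
  define T where "T = {J. Der J \<in> S \<and> weight \<omega> (Der J) = m}"
  define k where "k = (\<lambda>J. partial (Der J) \<Lambda>)"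
  have "T \<subseteq> (\<lambda>c. case c of Der J \<Rightarrow> J) ` S" by (force simp: T_def)
  then have T: "finite T" using S(1) finite_subset by auto
  have Tw: "\<And>J. J \<in> T \<Longrightarrow> weight \<omega> (Der J) = m" by (simp add: T_def)
  have Tt: "count J VT \<le> 2" if "J \<in> T" for J
    using that S(2) weight_t_weight[of J] by (force simp: T_def)
  have k: "diff_fun (k J)" "weight_le \<omega> m (k J)" "low_order (k J)" for J
    unfolding k_def \<omega>_def by (intro diff_fun_partial depends_only_partial L)+
  have first: "leading_form \<omega> m T k {#i#} (total_deriv i \<Lambda>)" if "0 < \<omega> i" for i
    unfolding T_def k_def by (rule leading_form_first[OF L(1) S(1) Sm S(3) that])
  note step = leading_form_step[OF _ T k(1,2) Tw]
  have "leading_form \<omega> m T k ttt (total_deriv VT (total_deriv VT (total_deriv VT \<Lambda>)))"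
    by (intro step first) (simp_all add: \<omega>)
  then obtain A where A: "diff_fun A" "depends_only {c. weight \<omega> c < m + 6} A"
    "\<And>z. total_deriv VT (total_deriv VT (total_deriv VT \<Lambda>)) z = A z + (\<Sum>J\<in>T. k J z * z (Der (J + ttt)))"
    unfolding leading_form_def by (auto simp: \<omega>)
  have "leading_form \<omega> m T k yy (total_deriv (VY j0) (total_deriv (VY j0) \<Lambda>))"
    unfolding yy_def by (intro step first) (simp_all add: \<omega>)
  then obtain B where B: "diff_fun B" "depends_only {c. weight \<omega> c < m + 6} B"
    "\<And>z. total_deriv (VY j0) (total_deriv (VY j0) \<Lambda>) z = B z + (\<Sum>J\<in>T. k J z * z (Der (J + yy)))"
    unfolding leading_form_def by (auto simp: \<omega> yy_def)
  \<comment> \<open>the part of the adjoint equation of weight below \<open>m + 6\<close>\<close>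
  define R where "R = (\<lambda>z. total_deriv VX (total_deriv VT \<Lambda>) z
     + deriv f (u_coord z) * total_deriv VT (total_deriv VT \<Lambda>) z - a * A z
     + b * ((\<Sum>j\<in>UNIV - {j0}. total_deriv (VY j) (total_deriv (VY j) \<Lambda>) z) + B z))"
  have twice: "weight_le \<omega> (m + 5) (total_deriv i (total_deriv j \<Lambda>))" if "\<omega> i + \<omega> j \<le> 5" for i j
  proof (rule weight_le_mono)
    show "weight_le \<omega> (m + \<omega> j + \<omega> i) (total_deriv i (total_deriv j \<Lambda>))"
      by (intro weight_le_total_deriv diff_fun_total_deriv L(1)) (use L(3) in \<open>simp add: \<omega>_def\<close>)
  qed (use that in simp)
  have AB: "weight_le \<omega> (m + 5) A" "weight_le \<omega> (m + 5) B"
    by (rule depends_only_mono[OF A(2)], force, rule depends_only_mono[OF B(2)], force)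
  have R: "weight_le \<omega> (m + 5) R"
    unfolding R_def
    by (intro depends_only_add depends_only_diff depends_only_mult depends_only_sum depends_only_const
        twice AB weight_le_mono[OF weight_le_f_u]) (simp_all add: \<omega>)
  have adj_eq: "adjoint_eqn f a b \<Lambda> z = R z + (\<Sum>J\<in>T. k J z * (- a * z (Der (J + ttt)) + b * z (Der (J + yy))))" for z
  proof -
    have lap: "laplace_y \<Lambda> z = total_deriv (VY j0) (total_deriv (VY j0) \<Lambda>) z
       + (\<Sum>j\<in>UNIV - {j0}. total_deriv (VY j) (total_deriv (VY j) \<Lambda>) z)"
      unfolding laplace_y_def by (rule sum.remove) auto
    have "(\<Sum>J\<in>T. k J z * (- a * z (Der (J + ttt)) + b * z (Der (J + yy))))
      = - a * (\<Sum>J\<in>T. k J z * z (Der (J + ttt))) + b * (\<Sum>J\<in>T. k J z * z (Der (J + yy)))"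
      by (simp add: sum_distrib_left sum.distrib[symmetric] algebra_simps del: union_mset_add_mset_right)
    then show ?thesis
      unfolding adjoint_eqn_def lap A(3) B(3) R_def by (simp add: algebra_simps)
  qed
  \<comment> \<open>the right-hand side without its heaviest term\<close>
  define H' where "H' = (\<lambda>z :: 'n jet. - (1 / a) * (z (Der {#VX, VT#})
     + total_deriv VT (total_deriv VT (\<lambda>w. f (u_coord w))) z
     + b * (\<Sum>j\<in>UNIV - {j0}. z (Der {#VY j, VY j#}))))"
  have dH': "diff_fun H'" unfolding H'_def
    by (intro diff_fun_mult diff_fun_add diff_fun_const diff_fun_coord diff_fun_sum diff_fun_total_deriv
        diff_fun_f_u f)
  have wH': "weight_le \<omega> 4 H'" unfolding H'_def
    by (intro depends_only_mult depends_only_add depends_only_const depends_only_sum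
        weight_le_coord weight_le_f_tt f) (simp_all add: \<omega>)
  have H: "?H = (\<lambda>z. H' z + (- b / a) * z (Der yy))"
  proof
    fix z :: "'n jet"
    have "(\<Sum>j\<in>UNIV. z (Der {#VY j, VY j#})) = z (Der yy) + (\<Sum>j\<in>UNIV - {j0}. z (Der {#VY j, VY j#}))"
      unfolding yy_def by (rule sum.remove) auto
    then show "?H z = H' z + (- b / a) * z (Der yy)"
      unfolding solved_rhs_def H'_def by (simp add: algebra_simps)
  qed
  have wH: "weight_le \<omega> (3 * \<omega> VT) ?H"
    unfolding H by (intro depends_only_add depends_only_mult depends_only_const weight_le_coord
        weight_le_mono[OF wH']) (simp_all add: \<omega> yy_def)
  have DDH: "total_derivs J ?H z = total_derivs J H' z + (- b / a) * z (Der (J + yy))" for J z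
    unfolding H total_derivs_add[OF dH' diff_fun_mult[OF diff_fun_const diff_fun_coord]]
      total_derivs_cmult[OF diff_fun_coord] total_derivs_coord ..
  \<comment> \<open>what remains of the adjoint equation on solutions besides the terms \<open>2 b k J u\<^bsub>J+yy\<^esub>\<close>\<close>
  define R' where "R' = (\<lambda>z. R (retract z) + (\<Sum>J\<in>T. k J z * (- a * total_derivs J H' (retract z))))"
  have R': "weight_le \<omega> (m + 5) R'"
    unfolding R'_def
  proof (intro depends_only_add depends_only_sum depends_only_mult depends_only_const)
    show "weight_le \<omega> (m + 5) (\<lambda>z. R (retract z))" by (rule weight_le_retract[OF wH R])
    fix J assume J: "J \<in> T"
    show "weight_le \<omega> (m + 5) (k J)" by (rule weight_le_mono[OF k(2)]) simp
    have "weight_le \<omega> (4 + (\<Sum>i\<in>#J. \<omega> i)) (total_derivs J H')" by (rule weight_le_total_derivs[OF dH' wH'])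
    then have "weight_le \<omega> (m + 5) (total_derivs J H')" by (rule weight_le_mono) (use Tw[OF J] in simp)
    then show "weight_le \<omega> (m + 5) (\<lambda>z. total_derivs J H' (retract z))" by (rule weight_le_retract[OF wH])
  qed
  have zero: "R' z + (\<Sum>J\<in>T. 2 * b * k J z * z (Der (J + yy))) = 0" for z
  proof -
    have "(\<Sum>J\<in>T. k J (retract z) * (- a * retract z (Der (J + ttt)) + b * retract z (Der (J + yy))))
       = (\<Sum>J\<in>T. k J z * (- a * total_derivs J H' (retract z)) + 2 * b * k J z * z (Der (J + yy)))"
    proof (intro sum.cong refl)
      fix J assume J: "J \<in> T"
      have "retract z (Der (J + ttt)) = total_derivs J ?H (retract z)" using retract_high[of "J + ttt" z] by simp
      moreover have yy: "retract z (Der (J + yy)) = z (Der (J + yy))"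
      proof (rule retract_low)
        show "weight t_weight (Der (J + yy)) \<le> 2"
          unfolding weight_t_weight using Tt[OF J] by (simp add: yy_def)
      qed
      ultimately have "retract z (Der (J + ttt)) = total_derivs J H' (retract z) + (- b / a) * z (Der (J + yy))"
        by (simp only: DDH)
      then have "- a * retract z (Der (J + ttt)) + b * retract z (Der (J + yy))
          = - a * total_derivs J H' (retract z) + 2 * b * z (Der (J + yy))"
        unfolding yy using ab(1) by (simp only: distrib_left) simp
      then show "k J (retract z) * (- a * retract z (Der (J + ttt)) + b * retract z (Der (J + yy)))
          = k J z * (- a * total_derivs J H' (retract z)) + 2 * b * k J z * z (Der (J + yy))"
        unfolding retract_low_order[OF k(3)] by (simp only: distrib_left) simp
    qed
    moreover have "adjoint_eqn f a b \<Lambda> (retract z) = 0"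
      using adj retract_on_shell[of z] by (simp add: vanishes_mod_def)
    ultimately show ?thesis unfolding adj_eq R'_def by (simp only: sum.distrib add.assoc)
  qed
  show ?thesis
  proof (cases "J0 \<in> T")
    case True
    show ?thesis
    proof
      fix z :: "'n jet"
      \<comment> \<open>moving only the coordinate \<open>J0 + yy\<close> changes nothing but its own term\<close>
      define z' where "z' = z(Der (J0 + yy) := z (Der (J0 + yy)) + 1)"
      have w: "weight \<omega> (Der (J0 + yy)) = m + 6"
        using Tw[OF True] by (simp add: \<omega> yy_def)
      have agree: "z c = z' c" if "c \<in> {c. weight \<omega> c \<le> m + 5}" for c
        using that w by (auto simp: z'_def)
      have "R' z = R' z'" by (rule depends_onlyD[OF R' agree])
      moreover have kz: "k J z' = k J z" for J
        by (rule depends_onlyD[OF weight_le_mono[OF k(2), of "m + 5"] agree[symmetric]]) auto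
      moreover have "(\<Sum>J\<in>T. 2 * b * k J z' * z' (Der (J + yy)))
         = (\<Sum>J\<in>T. 2 * b * k J z * z (Der (J + yy)) + (if J = J0 then 2 * b * k J z else 0))"
        by (intro sum.cong refl) (simp add: kz, simp add: z'_def algebra_simps)
      moreover have "\<dots> = (\<Sum>J\<in>T. 2 * b * k J z * z (Der (J + yy))) + 2 * b * k J0 z"
        using True T by (simp add: sum.distrib)
      ultimately have "2 * b * k J0 z = 0" using zero[of z] zero[of z'] by linarith
      then show "partial (Der J0) \<Lambda> z = 0" using ab(2) by (simp add: k_def)
    qed
  next
    case False
    then have "Der J0 \<notin> S" using J0 by (simp add: T_def \<omega>_def)
    then show ?thesis by (rule partial_outside[OF S(3)])
  qed
qed

text \<open>
  Otherwise the derivatives of \<open>u\<close> on which the multiplier depends have a maximal weight, at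
  which all derivatives of the multiplier are zero.
\<close>

lemma multiplier_jet_independent:
  fixes \<Lambda> :: "'n::finite jet \<Rightarrow> real"
  assumes ab: "a \<noteq> 0" "b \<noteq> 0" and f: "smooth_real f"
    and L: "diff_fun \<Lambda>" "low_order \<Lambda>"
    and adj: "vanishes_mod (eqn f a b) (adjoint_eqn f a b \<Lambda>)"
  shows "depends_only (range Ind) \<Lambda>"
proof (rule depends_only_if_partials_zero[OF L(1)])
  \<comment> \<open>any of the variables \<open>y\<^sub>j\<close> can be singled out\<close>
  define j0 :: 'n where "j0 = undefined"
  define U where "U = {J. partial (Der J) \<Lambda> \<noteq> (\<lambda>_. 0)}"
  define w where "w = (\<lambda>J. weight (lead_weight j0) (Der J))"
  obtain T where T: "finite T" "\<And>J. J \<notin> T \<Longrightarrow> partial (Der J) \<Lambda> = (\<lambda>_. 0)"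
    using L(1) by (rule diff_fun_Der_support) blast
  have fin: "finite U" by (rule finite_subset[OF _ T(1)]) (use T(2) in \<open>auto simp: U_def\<close>)
  have "U = {}"
  proof (rule ccontr)
    assume "U \<noteq> {}"
    then have "Max (w ` U) \<in> w ` U" using fin by simp
    then obtain J0 where J0: "J0 \<in> U" "Max (w ` U) = w J0" by auto
    have "weight_le (lead_weight j0) (w J0) \<Lambda>"
    proof (rule depends_only_if_partials_zero[OF L(1)])
      fix c assume c: "c \<notin> {c. weight (lead_weight j0) c \<le> w J0}"
      then obtain J where J: "c = Der J" by (cases c) auto
      have "J \<notin> U"
      proof
        assume "J \<in> U"
        then have "w J \<le> w J0" using Max_ge[of "w ` U" "w J"] fin J0(2) by simp
        then show False using c J by (simp add: w_def)
      qed
      then show "partial c \<Lambda> = (\<lambda>_. 0)" using J by (simp add: U_def)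
    qed
    from leading_coefficient_zero[OF ab f L this adj] have "partial (Der J0) \<Lambda> = (\<lambda>_. 0)"
      by (simp add: w_def)
    then show False using J0(1) by (simp add: U_def)
  qed
  then show "partial c \<Lambda> = (\<lambda>_. 0)" if "c \<notin> range Ind" for c
    using that by (cases c) (auto simp: U_def)
qed

lemma point_function_total_deriv:
  "depends_only (range Ind) F \<Longrightarrow> depends_only (range Ind) (total_deriv i F)"
  by (simp add: total_deriv_of_point_function depends_only_partial)

section \<open>Solution of the determining equation\<close>

text \<open>
  For a function of the independent variables the adjoint equation involves, besides these, only
  \<open>u\<close>, and both are unrestricted on the prolongation.
\<close>

lemma multiplier_equation:
  fixes \<Lambda> :: "'n::finite jet \<Rightarrow> real"
  assumes ab: "a \<noteq> 0" and f: "smooth_real f"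
    and L: "depends_only (range Ind) \<Lambda>"
    and adj: "vanishes_mod (eqn f a b) (adjoint_eqn f a b \<Lambda>)"
  shows "adjoint_eqn f a b \<Lambda> z = 0"
proof -
  interpret normal_form "eqn f a b" "solved_rhs f a b :: 'n jet \<Rightarrow> real" a
    by (rule normal_form_eqn[OF ab f])
  have same: "F (retract z) = F z" if "depends_only (range Ind) F" for F
    by (rule depends_onlyD[OF that]) (auto simp: retract_low)
  have "u_coord (retract z) = u_coord z" by (simp add: u_coord_def retract_low)
  moreover have "total_deriv i (total_deriv j \<Lambda>) (retract z) = total_deriv i (total_deriv j \<Lambda>) z" for i j
    by (intro same point_function_total_deriv L)
  moreover have "total_deriv i (total_deriv j (total_deriv k \<Lambda>)) (retract z) = total_deriv i (total_deriv j (total_deriv k \<Lambda>)) z" for i j k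
    by (intro same point_function_total_deriv L)
  ultimately have "adjoint_eqn f a b \<Lambda> (retract z) = adjoint_eqn f a b \<Lambda> z"
    by (simp add: adjoint_eqn_def laplace_y_def)
  then show ?thesis using adj retract_on_shell[of z] by (simp add: vanishes_mod_def)
qed

text \<open>
  The only term of the adjoint equation that contains \<open>u\<close> is \<open>f'(u) \<Lambda>\<^bsub>tt\<^esub>\<close>, and \<open>f'\<close> takes two
  different values.
\<close>

lemma multiplier_linear_in_t:
  fixes \<Lambda> :: "'n::finite jet \<Rightarrow> real"
  assumes f: "\<exists>v. deriv (deriv f) v \<noteq> 0"
    and L: "depends_only (range Ind) \<Lambda>"
    and adj: "\<And>z. adjoint_eqn f a b \<Lambda> z = 0"
  shows "total_deriv VT (total_deriv VT \<Lambda>) z = 0"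
proof -
  have "\<exists>v w. deriv f v \<noteq> deriv f w"
  proof (rule ccontr)
    assume "\<not> ?thesis"
    then have "deriv f = (\<lambda>_. deriv f 0)" by blast
    then have "deriv (deriv f) v = 0" for v by (metis deriv_const)
    then show False using f by blast
  qed
  then obtain v w where vw: "deriv f v \<noteq> deriv f w" by blast
  have same: "F (z(Der {#} := s)) = F z" if "depends_only (range Ind) F" for F s
    by (rule depends_onlyD[OF that]) auto
  have 1: "total_deriv i (total_deriv j \<Lambda>) (z(Der {#} := s)) = total_deriv i (total_deriv j \<Lambda>) z" for i j s
    by (intro same point_function_total_deriv L)
  have 2: "total_deriv i (total_deriv j (total_deriv k \<Lambda>)) (z(Der {#} := s))
      = total_deriv i (total_deriv j (total_deriv k \<Lambda>)) z" for i j k s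
    by (intro same point_function_total_deriv L)
  have "adjoint_eqn f a b \<Lambda> (z(Der {#} := v)) - adjoint_eqn f a b \<Lambda> (z(Der {#} := w))
      = (deriv f v - deriv f w) * total_deriv VT (total_deriv VT \<Lambda>) z"
    by (simp add: adjoint_eqn_def laplace_y_def 1 2 u_coord_def left_diff_distrib)
  then show ?thesis using adj vw by simp
qed

lemma xy_fun_diff_fun: fixes F :: "'n::finite jet \<Rightarrow> real" shows "xy_fun F \<Longrightarrow> diff_fun F"
  by (rule diff_funI[of _ "insert (Ind VX) (range (\<lambda>j. Ind (VY j)))"]) (auto simp: xy_fun_def)

lemma xy_fun_Ind: "xy_fun F \<Longrightarrow> depends_only (range Ind) F"
  by (rule depends_only_mono[of "insert (Ind VX) (range (\<lambda>j. Ind (VY j)))"]) (auto simp: xy_fun_def)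

lemma xy_fun_total_deriv_t: "xy_fun F \<Longrightarrow> total_deriv VT F = (\<lambda>_. 0)"
  using partial_outside[of "insert (Ind VX) (range (\<lambda>j. Ind (VY j)))" F "Ind VT"]
  by (auto simp: total_deriv_of_point_function[OF xy_fun_Ind] xy_fun_def)

lemma xy_funI:
  assumes "diff_fun F" "depends_only (range Ind) F" "\<And>z. total_deriv VT F z = 0"
  shows "xy_fun F"
proof -
  have "depends_only (insert (Ind VX) (range (\<lambda>j. Ind (VY j)))) F"
  proof (rule depends_only_if_partials_zero[OF assms(1)])
    fix c :: "'a coord" assume c: "c \<notin> insert (Ind VX) (range (\<lambda>j. Ind (VY j)))"
    show "partial c F = (\<lambda>_. 0)"
    proof (cases "c = Ind VT")
      case True
      then show ?thesis using assms(3) by (auto simp: total_deriv_of_point_function[OF assms(2)])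
    next
      case False
      then have "c \<notin> range Ind" using c by (auto) (metis ivar.exhaust rangeI)
      then show ?thesis by (rule partial_outside[OF assms(2)])
    qed
  qed
  then show ?thesis using assms(1) by (simp add: xy_fun_def diff_fun_def)
qed

lemma diff_fun_chi: "diff_fun \<phi>0 \<Longrightarrow> diff_fun \<phi>1 \<Longrightarrow> diff_fun (chi \<phi>0 \<phi>1)"
  unfolding chi_def[abs_def] by (intro diff_fun_add diff_fun_mult diff_fun_coord)

lemma laplace_chi:
  fixes \<phi>0 \<phi>1 :: "'n::finite jet \<Rightarrow> real"
  assumes "diff_fun \<phi>0" "diff_fun \<phi>1"
  shows "laplace_y (chi \<phi>0 \<phi>1) z = laplace_y \<phi>0 z + z (Ind VT) * laplace_y \<phi>1 z"
proof -
  have 1: "total_deriv (VY j) (\<lambda>z. F z + z (Ind VT) * G z) = (\<lambda>z. total_deriv (VY j) F z + z (Ind VT) * total_deriv (VY j) G z)"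
    if "diff_fun F" "diff_fun G" for j :: 'n and F G
    by (rule ext) (simp add: that total_deriv_add total_deriv_mult diff_fun_mult diff_fun_coord)
  show ?thesis
    by (simp add: laplace_y_def chi_def[abs_def] 1 assms diff_fun_total_deriv sum.distrib sum_distrib_left)
qed

text \<open>
  A function linear in \<open>t\<close> with \<open>\<phi>1\<close> its slope and \<open>\<phi>0\<close> its value at \<open>t = 0\<close>. The remaining
  equation \<open>\<Lambda>\<^bsub>tx\<^esub> + b \<Delta>\<Lambda> = 0\<close> is linear in \<open>t\<close> as well; its two coefficients are the
  system.
\<close>

lemma multiplier_as_chi:
  fixes \<Lambda> :: "'n::finite jet \<Rightarrow> real"
  assumes b: "b \<noteq> 0" and L: "diff_fun \<Lambda>" "depends_only (range Ind) \<Lambda>"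
    and tt: "\<And>z. total_deriv VT (total_deriv VT \<Lambda>) z = 0"
    and adj: "\<And>z. adjoint_eqn f a b \<Lambda> z = 0"
  obtains \<phi>0 \<phi>1 where "xy_fun \<phi>0" "xy_fun \<phi>1" "phi_system b \<phi>0 \<phi>1" "\<Lambda> = chi \<phi>0 \<phi>1"
proof -
  define \<phi>1 where "\<phi>1 = total_deriv VT \<Lambda>"
  define \<phi>0 where "\<phi>0 = (\<lambda>z. \<Lambda> z - z (Ind VT) * \<phi>1 z)"
  have d1: "diff_fun \<phi>1" unfolding \<phi>1_def by (intro diff_fun_total_deriv L)
  have d0: "diff_fun \<phi>0" unfolding \<phi>0_def by (intro diff_fun_diff diff_fun_mult diff_fun_coord L d1)
  have i1: "depends_only (range Ind) \<phi>1" unfolding \<phi>1_def by (intro point_function_total_deriv L)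
  have i0: "depends_only (range Ind) \<phi>0" unfolding \<phi>0_def
    by (intro depends_only_diff depends_only_mult depends_only_coord L i1) simp
  have t1: "total_deriv VT \<phi>1 z = 0" for z using tt by (simp add: \<phi>1_def)
  have "total_deriv VT \<phi>0 z = 0" for z
    unfolding \<phi>0_def
    by (simp add: total_deriv_diff total_deriv_mult diff_fun_mult diff_fun_coord L d1 t1) (simp add: \<phi>1_def)
  then have xy: "xy_fun \<phi>0" "xy_fun \<phi>1" using xy_funI d0 i0 d1 i1 t1 by blast+
  have chi: "\<Lambda> = chi \<phi>0 \<phi>1" by (rule ext) (simp add: chi_def \<phi>0_def)
  have tt0: "total_deriv VT (total_deriv VT \<Lambda>) = (\<lambda>_. 0)" using tt by blast
  have eq: "total_deriv VX \<phi>1 z + b * laplace_y \<Lambda> z = 0" for z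
    using adj[of z] by (simp add: adjoint_eqn_def tt0 \<phi>1_def)
  have lap1: "laplace_y \<phi>1 z = 0" for z
  proof -
    have "total_deriv VT (\<lambda>z. total_deriv VX \<phi>1 z + b * laplace_y \<Lambda> z) z = 0"
      by (simp add: eq)
    moreover have "total_deriv VT (\<lambda>z. total_deriv VX \<phi>1 z + b * laplace_y \<Lambda> z) z
      = total_deriv VT (total_deriv VX \<phi>1) z + b * total_deriv VT (laplace_y \<Lambda>) z"
      by (simp add: total_deriv_add total_deriv_cmult diff_fun_mult diff_fun_const diff_fun_total_deriv
          d1 diff_fun_laplace L)
    moreover have "total_deriv VT (total_deriv VX \<phi>1) z = 0"
    proof -
      have "total_deriv VT \<phi>1 = (\<lambda>_. 0)" using t1 by (rule ext)
      then show ?thesis by (simp add: total_deriv_commute[OF d1, of VT VX])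
    qed
    moreover have "total_deriv VT (laplace_y \<Lambda>) z = laplace_y \<phi>1 z"
      unfolding laplace_y_def[abs_def] \<phi>1_def
      by (simp add: total_deriv_sum diff_fun_total_deriv L total_deriv_commute[of _ VT "VY _"])
    ultimately show ?thesis using b by simp
  qed
  moreover have "laplace_y \<phi>0 z = - total_deriv VX \<phi>1 z / b" for z
    using eq[of z] b lap1[of z] laplace_chi[OF d0 d1, of z] by (simp add: chi field_simps)
  ultimately have "phi_system b \<phi>0 \<phi>1" by (simp add: phi_system_def)
  then show ?thesis using that xy chi by blast
qed

section \<open>Currents with a given multiplier\<close>

lemma diff_fun_chi_current:
  fixes h :: "'n::finite jet \<Rightarrow> real"
  assumes f: "smooth_real f" and h: "diff_fun h"
  shows "diff_fun (chi_current f a b h i)"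
proof -
  have df: "smooth_real (deriv f)"
    unfolding smooth_real_def
  proof (intro allI)
    fix k x
    have "(deriv ^^ k) (deriv f) = (deriv ^^ Suc k) f" by (simp only: funpow_Suc_right o_apply)
    then show "(deriv ^^ k) (deriv f) differentiable at x"
      using f unfolding smooth_real_def by metis
  qed
  note d = diff_fun_add diff_fun_diff diff_fun_mult diff_fun_uminus diff_fun_const diff_fun_total_deriv
    diff_fun_u diff_fun_f_u[OF f] diff_fun_f_u[OF df] h
  show ?thesis
  proof (cases i)
    case VX
    have "chi_current f a b h VX = (\<lambda>z. - u_coord z * total_deriv VT h z)" by (rule ext) simp
    then show ?thesis unfolding VX by (simp only:) (intro d)
  next
    case VT
    have "chi_current f a b h VT = (\<lambda>z. (total_deriv VX u_coord z + deriv f (u_coord z) * total_deriv VT u_coord z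
        + a * total_deriv VT (total_deriv VT u_coord) z) * h z
     - (a * total_deriv VT u_coord z + f (u_coord z)) * total_deriv VT h z)" by (rule ext) simp
    then show ?thesis unfolding VT by (simp only:) (intro d)
  next
    case (VY j)
    have "chi_current f a b h (VY j) =
        (\<lambda>z. b * (total_deriv (VY j) u_coord z * h z - u_coord z * total_deriv (VY j) h z))"
      by (rule ext) simp
    then show ?thesis unfolding VY by (simp only:) (intro d)
  qed
qed

text \<open>
  The current arises from \<open>h E\<close> by integration by parts; what is left over has
  \<open>h\<^bsub>tt\<^esub>\<close> or \<open>h\<^bsub>tx\<^esub> + b \<Delta>h\<close> as a factor.
\<close>

lemma total_div_chi_current:
  fixes h :: "'n::finite jet \<Rightarrow> real"
  assumes f: "smooth_real f" and h: "diff_fun h"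
    and tt: "\<And>z. total_deriv VT (total_deriv VT h) z = 0"
    and tx: "\<And>z. total_deriv VX (total_deriv VT h) z + b * laplace_y h z = 0"
  shows "total_div (chi_current f a b h) z = h z * eqn f a b z"
proof -
  let ?u = "u_coord :: 'n jet \<Rightarrow> real" and ?f = "\<lambda>w :: 'n jet. f (u_coord w)"
  have f': "deriv f (u_coord z) * total_deriv VT ?u z = total_deriv VT ?f z" for z
    using total_deriv_real_coord[OF f, of VT "Der {#}" z] by (simp add: total_deriv_u u_coord_def)
  note d = diff_fun_add diff_fun_diff diff_fun_mult diff_fun_uminus diff_fun_const diff_fun_total_deriv
    diff_fun_u diff_fun_f_u[OF f] h
  note D = total_deriv_add total_deriv_diff total_deriv_mult total_deriv_uminus total_deriv_cmult d
  have "chi_current f a b h VT = (\<lambda>z. (total_deriv VX ?u z + total_deriv VT ?f z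
        + a * total_deriv VT (total_deriv VT ?u) z) * h z
     - (a * total_deriv VT ?u z + ?f z) * total_deriv VT h z)" by (rule ext) (simp add: f')
  then have T: "total_deriv VT (chi_current f a b h VT) z =
     (total_deriv VT (total_deriv VX ?u) z + total_deriv VT (total_deriv VT ?f) z
        + a * total_deriv VT (total_deriv VT (total_deriv VT ?u)) z) * h z
     + total_deriv VX ?u z * total_deriv VT h z"
    by (simp add: D tt) (simp add: algebra_simps)
  have "chi_current f a b h VX = (\<lambda>z. (- ?u z) * total_deriv VT h z)" by (rule ext) simp
  then have X: "total_deriv VX (chi_current f a b h VX) z =
     - total_deriv VX ?u z * total_deriv VT h z - ?u z * total_deriv VX (total_deriv VT h) z"
    by (simp add: D)
  have Y: "total_deriv (VY j) (chi_current f a b h (VY j)) z =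
     b * (total_deriv (VY j) (total_deriv (VY j) ?u) z * h z) - b * (?u z * total_deriv (VY j) (total_deriv (VY j) h) z)" for j
  proof -
    have "chi_current f a b h (VY j) =
        (\<lambda>z. b * (total_deriv (VY j) ?u z * h z - ?u z * total_deriv (VY j) h z))" by (rule ext) simp
    then show ?thesis by (simp add: D) (simp add: algebra_simps)
  qed
  have "total_div (chi_current f a b h) z = h z * eqn f a b z
    - ?u z * (total_deriv VX (total_deriv VT h) z + b * laplace_y h z)"
    unfolding total_div_def T X Y eqn_def laplace_y_def sum_subtractf
      sum_distrib_left[symmetric] sum_distrib_right[symmetric] total_deriv_commute[OF diff_fun_u, of VT VX]
    by (simp add: algebra_simps)
  then show ?thesis using tx by simp
qed

lemma chi_system:
  fixes \<phi>0 \<phi>1 :: "'n::finite jet \<Rightarrow> real"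
  assumes "b \<noteq> 0" "xy_fun \<phi>0" "xy_fun \<phi>1" "phi_system b \<phi>0 \<phi>1"
  shows "total_deriv VT (total_deriv VT (chi \<phi>0 \<phi>1)) z = 0"
    and "total_deriv VX (total_deriv VT (chi \<phi>0 \<phi>1)) z + b * laplace_y (chi \<phi>0 \<phi>1) z = 0"
proof -
  note d = xy_fun_diff_fun[OF assms(2)] xy_fun_diff_fun[OF assms(3)]
  have t: "total_deriv VT (chi \<phi>0 \<phi>1) = \<phi>1"
    by (rule ext) (simp add: chi_def[abs_def] total_deriv_add total_deriv_mult diff_fun_mult diff_fun_coord d
        xy_fun_total_deriv_t assms)
  show "total_deriv VT (total_deriv VT (chi \<phi>0 \<phi>1)) z = 0"
    by (simp add: t xy_fun_total_deriv_t assms)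
  show "total_deriv VX (total_deriv VT (chi \<phi>0 \<phi>1)) z + b * laplace_y (chi \<phi>0 \<phi>1) z = 0"
    using assms(1,4) by (simp add: t laplace_chi d phi_system_def)
qed

lemma chi_current_conserved:
  fixes \<phi>0 \<phi>1 :: "'n::finite jet \<Rightarrow> real"
  assumes "a \<noteq> 0" "b \<noteq> 0" "smooth_real f" "xy_fun \<phi>0" "xy_fun \<phi>1" "phi_system b \<phi>0 \<phi>1"
  shows "conservation_law (eqn f a b) (chi_current f a b (chi \<phi>0 \<phi>1))"
proof -
  interpret normal_form "eqn f a b" "solved_rhs f a b :: 'n jet \<Rightarrow> real" a
    by (rule normal_form_eqn[OF assms(1,3)])
  have d: "diff_fun (chi \<phi>0 \<phi>1)" by (intro diff_fun_chi xy_fun_diff_fun assms)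
  show ?thesis
    unfolding conservation_law_def vanishes_mod_def
    using vanishes_E diff_fun_chi_current[OF assms(3) d]
      total_div_chi_current[OF assms(3) d chi_system[OF assms(2,4-6)]]
    by (simp add: vanishes_mod_def)
qed

text \<open>
  The characteristic form of \<open>P\<close> and the current of \<open>\<chi>\<close> have the same multiplier, hence the same
  divergence identically. Their difference is one of the currents that are trivial by
  definition, so no exactness of the divergence complex is involved.
\<close>

lemma conservation_law_equivalent_chi:
  fixes P :: "'n::finite current"
  assumes ab: "a \<noteq> 0" "b \<noteq> 0" and f: "smooth_real f" and f'': "\<exists>v. deriv (deriv f) v \<noteq> 0"
    and P: "conservation_law (eqn f a b) P"
  shows "\<exists>\<phi>0 \<phi>1. xy_fun \<phi>0 \<and> xy_fun \<phi>1 \<and> phi_system b \<phi>0 \<phi>1 \<and>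
    equivalent_laws (eqn f a b) P (chi_current f a b (chi \<phi>0 \<phi>1))"
proof -
  interpret normal_form "eqn f a b" "solved_rhs f a b :: 'n jet \<Rightarrow> real" a
    by (rule normal_form_eqn[OF ab(1) f])
  obtain \<Lambda> Q where Q: "diff_fun \<Lambda>" "low_order \<Lambda>" "\<And>i. diff_fun (Q i)"
    "\<And>i. vanishes_mod (eqn f a b) (\<lambda>z. P i z - Q i z)" "\<And>z. total_div Q z = \<Lambda> z * eqn f a b z"
    using characteristic_form[OF P] by blast
  have "euler_pair \<Lambda> (eqn f a b) = adjoint_eqn f a b \<Lambda>"
    by (rule ext) (rule euler_pair_eqn[OF f Q(1)])
  then have adj: "vanishes_mod (eqn f a b) (adjoint_eqn f a b \<Lambda>)"
    using multiplier_equation_on_shell[OF Q(1) Q(3) Q(5)] by simp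
  have ind: "depends_only (range Ind) \<Lambda>"
    by (rule multiplier_jet_independent[OF ab f Q(1,2) adj])
  have adj0: "adjoint_eqn f a b \<Lambda> z = 0" for z
    by (rule multiplier_equation[OF ab(1) f ind adj])
  obtain \<phi>0 \<phi>1 where \<phi>: "xy_fun \<phi>0" "xy_fun \<phi>1" "phi_system b \<phi>0 \<phi>1" "\<Lambda> = chi \<phi>0 \<phi>1"
    using multiplier_as_chi[OF ab(2) Q(1) ind multiplier_linear_in_t[OF f'' ind adj0] adj0] by blast
  define C where "C = chi_current f a b (chi \<phi>0 \<phi>1)"
  have C: "conservation_law (eqn f a b) C"
    unfolding C_def by (rule chi_current_conserved[OF ab f \<phi>(1-3)])
  have dP: "diff_fun (P i)" and dC: "diff_fun (C i)" for i
    using P C by (simp_all add: conservation_law_def)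
  have divC: "total_div C z = \<Lambda> z * eqn f a b z" for z
    unfolding C_def \<phi>(4)[symmetric]
    by (rule total_div_chi_current[OF f Q(1)])
      (use chi_system[OF ab(2) \<phi>(1-3)] \<phi>(4) in auto)
  have "trivial_law (eqn f a b) (\<lambda>i z. P i z - C i z)"
    unfolding trivial_law_def
  proof (intro conjI exI)
    show "conservation_law (eqn f a b) (\<lambda>i z. P i z - C i z)"
      using P C unfolding conservation_law_def vanishes_mod_def
      by (simp add: total_div_diff diff_fun_diff)
    show "\<forall>i. diff_fun (\<lambda>z. P i z - Q i z) \<and> vanishes_mod (eqn f a b) (\<lambda>z. P i z - Q i z)"
      using Q dP by (simp add: diff_fun_diff)
    show "\<forall>i. diff_fun (\<lambda>z. Q i z - C i z)" using Q dC by (simp add: diff_fun_diff)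
    show "\<forall>z. total_div (\<lambda>i z. Q i z - C i z) z = 0" using Q dC by (simp add: total_div_diff divC)
    show "\<forall>i z. P i z - C i z = P i z - Q i z + (Q i z - C i z)" by simp
  qed
  then have "equivalent_laws (eqn f a b) P C" unfolding equivalent_laws_def using P C by blast
  then show ?thesis unfolding C_def using \<phi>(1-3) by blast
qed

theorem theorem1:
  fixes f :: "real \<Rightarrow> real" and a b :: real
  assumes "a \<noteq> 0" and "b \<noteq> 0"
    and "smooth_real f"
    and "\<exists>v. deriv (deriv f) v \<noteq> 0"
  shows "(\<forall>\<phi>0 \<phi>1 :: 'n::finite jet \<Rightarrow> real.
            xy_fun \<phi>0 \<and> xy_fun \<phi>1 \<and> phi_system b \<phi>0 \<phi>1 \<longrightarrow>
            conservation_law (eqn f a b) (chi_current f a b (chi \<phi>0 \<phi>1))) \<and>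
         (\<forall>P :: 'n current. nontrivial_law (eqn f a b) P \<longrightarrow>
            (\<exists>\<phi>0 \<phi>1. xy_fun \<phi>0 \<and> xy_fun \<phi>1 \<and> phi_system b \<phi>0 \<phi>1 \<and>
               equivalent_laws (eqn f a b) P (chi_current f a b (chi \<phi>0 \<phi>1))))"
  using chi_current_conserved[OF assms(1-3)] conservation_law_equivalent_chi[OF assms]
  unfolding nontrivial_law_def by blast

end
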